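(* Let $\nabla$ be an $h$-connection of $E$ such that for each $\varepsilon\in\{+,-\}$, the generators $C_{\varepsilon,1},C_{\varepsilon,2}$ of the topological holonomy group $G_{\hat\nabla,\varepsilon}$ satisfy $$\theta_{+,1}=q_1\pi,\quad\theta_{+,2}=\psi_2\pi,\quad\theta_{-,1}=\psi_1\pi,\quad\theta_{-,2}=q_2\pi,\quad\phi_\pm\in(0,\pi/2]$$ for $q_1,q_2\in\mathbb{Q}\setminus\mathbb{Z}$ and $\psi_1,\psi_2\in\mathbb{R}\setminus\mathbb{Q}$. Then the topological holonomy group $G_\nabla$ is dense in $SO(4)$.
   Context: Let $T^2=S^1\times S^1$ with $S^1=\mathbb{R}/2\pi\mathbb{Z}$ and let $\mathrm{pr}:\mathbb{R}^2\to T^2$ be the projection. $E$ is an oriented real vector bundle of rank 4 over $T^2$ with a positive-definite metric $h$. An $h$-connection is a connection $\nabla$ of $E$ with $\nabla h=0$. Definition of $G_\nabla$: let $(\tilde v_1,\dots,\tilde v_4)$ be a positively oriented orthonormal basis of $\mathrm{pr}^*E_{(0,0)}$, and let $\tilde\xi_{i,x}$ (resp. $\tilde\xi_{i,y}$) be the $\nabla$-parallel sections of $\mathrm{pr}^*E$ along the $x$-axis (resp. $y$-axis) with value $\tilde v_i$ at $(0,0)$. Identifying the fibers of the pull-back at $(x+2\pi m,y+2\pi n)$ and $(x,y)$ for $m,n\in\mathbb{Z}$, there are $A_1,A_2\in SO(4)$ with $(\tilde\xi_{i,x}(a+2\pi,0))_{i}=(\tilde\xi_{i,x}(a,0))_{i}A_1$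 and $(\tilde\xi_{i,y}(0,b+2\pi))_{i}=(\tilde\xi_{i,y}(0,b))_{i}A_2$ for all $a,b\in\mathbb{R}$ (row vectors times matrices). The topological holonomy group $G_\nabla$ of $\nabla$ at $\mathrm{pr}(0,0)$ is the subgroup of $SO(4)$ generated by $A_1,A_2$ (determined up to conjugation). Definition of $G_{\hat\nabla,\varepsilon}$: $\bigwedge^2E$ with the induced metric $\hat h$ decomposes into rank 3 subbundles $\bigwedge^2_+E\oplus\bigwedge^2_-E$: for a local positively oriented orthonormal frame $(e_1,e_2,e_3,e_4)$ of $E$, $\bigwedge^2_\pm E$ has the local orthonormal frame $\Omega_{\pm,1}=\frac1{\sqrt2}(e_1\wedge e_2\pm e_3\wedge e_4)$, $\Omega_{\pm,2}=\frac1{\sqrt2}(e_1\wedge e_3\pm e_4\wedge e_2)$, $\Omega_{\pm,3}=\frac1{\sqrt2}(e_1\wedge e_4\pm e_2\wedge e_3)$, and is oriented by it. $\nabla$ induces an $\hat h$-connection $\hat\nabla$ of $\bigwedge^2E$, which restricts to $\bigwedge^2_\pm E$. For $\varepsilon\in\{+,-\}$ fix a positively oriented orthonormal basis $(\omega_{\varepsilon,1},\omega_{\varepsilon,2},\omega_{\varepsilon,3})$ of the fiber of $\bigwedge^2_\varepsilon E$ at $\mathrm{pr}(0,0)$; the $\hat\nabla$-parallel sections $\tilde\Omega_{\varepsilon,i,x}$, $\tilde\Omega_{\varepsilon,i,y}$ of $\mathrm{pr}^*\bigwedge^2_\varepsilon E$ along the $x$- and $y$-axis with value $\omega_{\varepsilon,i}$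 at $(0,0)$ satisfy $(\tilde\Omega_{\varepsilon,i,x}(a+2\pi,0))_{i}=(\tilde\Omega_{\varepsilon,i,x}(a,0))_{i}C_{\varepsilon,1}$ and $(\tilde\Omega_{\varepsilon,i,y}(0,b+2\pi))_{i}=(\tilde\Omega_{\varepsilon,i,y}(0,b))_{i}C_{\varepsilon,2}$ for all $a,b\in\mathbb R$, with $C_{\varepsilon,1},C_{\varepsilon,2}\in SO(3)$. $G_{\hat\nabla,\varepsilon}$ is the subgroup of $SO(3)$ generated by $C_{\varepsilon,1},C_{\varepsilon,2}$. Angles: put $C(\theta)=\begin{pmatrix}1&0&0\\0&\cos\theta&-\sin\theta\\0&\sin\theta&\cos\theta\end{pmatrix}$. The bases $(\omega_{\varepsilon,i})$ are chosen so that $C_{\varepsilon,1}=C(\theta_{\varepsilon,1})$ with $\theta_{\varepsilon,1}\in[0,2\pi)$; write $C_{\varepsilon,2}=V_{\varepsilon,2}C(\theta_{\varepsilon,2})\,{}^tV_{\varepsilon,2}$ with $\theta_{\varepsilon,2}\in[0,2\pi)$, $V_{\varepsilon,2}\in SO(3)$. When $C_{\varepsilon,1},C_{\varepsilon,2}\ne E_3$ (the identity), the choice is made so that $\phi_\varepsilon\in[0,\pi/2]$ is the angle between ${}^t[1\ 0\ 0]$ and the first column of $V_{\varepsilon,2}$ (the angle between the rotation axes). *)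

theory Defs
  imports
    "HOL-Analysis.Analysis"
    "HOL-Algebra.Generated_Groups"
    "HOL-Library.Function_Algebras"
begin

primrec Ck_on :: "nat \<Rightarrow> 'a::real_normed_vector set \<Rightarrow> ('a \<Rightarrow> 'b::real_normed_vector) \<Rightarrow> bool" where
  "Ck_on 0 S f \<longleftrightarrow> continuous_on S f"
| "Ck_on (Suc k) S f \<longleftrightarrow>
     f differentiable_on S \<and> (\<forall>v. Ck_on k S (\<lambda>x. frechet_derivative f (at x) v))"

text \<open>This is only used for open sets \<open>S\<close> in finite-dimensional spaces.\<close>

definition smooth_on :: "'a::real_normed_vector set \<Rightarrow> ('a \<Rightarrow> 'b::real_normed_vector) \<Rightarrow> bool" where
  "smooth_on S f \<longleftrightarrow> (\<forall>k. Ck_on k S f)"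

definition circle_rel :: "real \<Rightarrow> real \<Rightarrow> bool" where
  "circle_rel x y \<longleftrightarrow> (\<exists>k::int. y = x + 2 * pi * of_int k)"

lemma equivp_circle_rel: "equivp circle_rel"
proof (rule equivpI)
  show "reflp circle_rel"
    unfolding reflp_def circle_rel_def by (auto intro: exI[of _ "0::int"])
  show "symp circle_rel"
  proof (rule sympI)
    fix x y assume "circle_rel x y"
    then obtain k :: int where "y = x + 2 * pi * of_int k"
      unfolding circle_rel_def by blast
    then have "x = y + 2 * pi * of_int (- k)" by simp
    then show "circle_rel y x" unfolding circle_rel_def by blast
  qed
  show "transp circle_rel"
  proof (rule transpI)
    fix x y z assume "circle_rel x y" "circle_rel y z"
    then obtain k l :: int where "y = x + 2 * pi * of_int k" "z = y + 2 * pi * of_int l"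
      unfolding circle_rel_def by blast
    then have "z = x + 2 * pi * of_int (k + l)" by (simp add: algebra_simps)
    then show "circle_rel x z" unfolding circle_rel_def by blast
  qed
qed

quotient_type circle = real / circle_rel
  by (rule equivp_circle_rel)

type_synonym torus = "circle \<times> circle"

definition pr :: "real \<times> real \<Rightarrow> torus" where
  "pr z = (abs_circle (fst z), abs_circle (snd z))"

text \<open>The topology and the smooth structure of the torus are the quotient ones. The tangent space
  at every point is identified with \<open>\<real>\<^sup>2\<close> by means of \<open>pr\<close>.\<close>

definition torus_open :: "torus set \<Rightarrow> bool" where
  "torus_open U \<longleftrightarrow> open (pr -` U)"

definition torus_smooth_on :: "torus set \<Rightarrow> (torus \<Rightarrow> 'b::real_normed_vector) \<Rightarrow> bool" where
  "torus_smooth_on U f \<longleftrightarrow> smooth_on (pr -` U) (\<lambda>z. f (pr z))"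

text \<open>The row vector \<open>(b\<^sub>1, \<dots>, b\<^sub>n)\<close> of elements of a vector space, times a real matrix.\<close>

definition row_mult :: "'v::real_vector^'n::finite \<Rightarrow> real^'n^'n \<Rightarrow> 'v^'n" where
  "row_mult b A = (\<chi> j. \<Sum>i\<in>UNIV. (A $ i $ j) *\<^sub>R (b $ i))"

definition is_basis :: "'v::real_vector set \<Rightarrow> 'v^'n::finite \<Rightarrow> bool" where
  "is_basis V b \<longleftrightarrow>
     inj (\<lambda>i. b $ i) \<and> independent (range (\<lambda>i. b $ i)) \<and> span (range (\<lambda>i. b $ i)) = V"

text \<open>The fibres of a bundle of rank \<open>CARD('n)\<close> are linear subspaces of a type \<open>'v\<close>, which carries
  no topology and only serves as a container for the abstract fibres (for instance their direct
  sum). Topology, smooth structure and orientation are those of an atlas of local frames.\<close>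

record ('v, 'n) vbundle =
  fibre :: "torus \<Rightarrow> 'v set"
  atlas :: "(torus set \<times> (torus \<Rightarrow> 'v^'n)) set"

definition oriented_vector_bundle :: "('v::real_vector, 'n::finite) vbundle \<Rightarrow> bool" where
  "oriented_vector_bundle E \<longleftrightarrow>
     (\<forall>(U, e)\<in>atlas E. torus_open U \<and> (\<forall>p\<in>U. is_basis (fibre E p) (e p))) \<and>
     (\<forall>p. \<exists>(U, e)\<in>atlas E. p \<in> U) \<and>
     (\<forall>(U, e)\<in>atlas E. \<forall>(W, f)\<in>atlas E.
        \<exists>g :: torus \<Rightarrow> real^'n^'n. torus_smooth_on (U \<inter> W) g \<and>
          (\<forall>p\<in>U \<inter> W. f p = row_mult (e p) (g p) \<and> det (g p) > 0))"

definition smooth_section ::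
    "('v::real_vector, 'n::finite) vbundle \<Rightarrow> torus set \<Rightarrow> (torus \<Rightarrow> 'v) \<Rightarrow> bool" where
  "smooth_section E U s \<longleftrightarrow>
     (\<forall>p\<in>U. s p \<in> fibre E p) \<and>
     (\<forall>(W, e)\<in>atlas E. \<exists>c :: torus \<Rightarrow> real^'n. torus_smooth_on (U \<inter> W) c \<and>
        (\<forall>p\<in>U \<inter> W. s p = (\<Sum>i\<in>UNIV. (c p $ i) *\<^sub>R (e p $ i))))"

definition positive_basis ::
    "('v::real_vector, 'n::finite) vbundle \<Rightarrow> torus \<Rightarrow> 'v^'n \<Rightarrow> bool" where
  "positive_basis E p b \<longleftrightarrow>
     (\<exists>(U, e)\<in>atlas E. p \<in> U \<and> (\<exists>M. b = row_mult (e p) M \<and> det M > 0))"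

definition bundle_metric ::
    "('v::real_vector, 'n::finite) vbundle \<Rightarrow> (torus \<Rightarrow> 'v \<Rightarrow> 'v \<Rightarrow> real) \<Rightarrow> bool" where
  "bundle_metric E h \<longleftrightarrow>
     (\<forall>p. \<forall>u\<in>fibre E p. \<forall>v\<in>fibre E p.
        h p u v = h p v u \<and>
        (\<forall>w\<in>fibre E p. h p (u + v) w = h p u w + h p v w) \<and>
        (\<forall>a. h p (a *\<^sub>R u) v = a * h p u v) \<and>
        (u \<noteq> 0 \<longrightarrow> h p u u > 0)) \<and>
     (\<forall>(U, e)\<in>atlas E. \<forall>i j. torus_smooth_on U (\<lambda>p. h p (e p $ i) (e p $ j)))"

definition positive_orthonormal_basis ::
    "('v::real_vector, 'n::finite) vbundle \<Rightarrow> (torus \<Rightarrow> 'v \<Rightarrow> 'v \<Rightarrow> real) \<Rightarrow> torus \<Rightarrow> 'v^'n \<Rightarrow> bool" where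
  "positive_orthonormal_basis E h p b \<longleftrightarrow>
     positive_basis E p b \<and> (\<forall>i j. h p (b $ i) (b $ j) = (if i = j then 1 else 0))"

text \<open>A connection assigns to a tangent vector \<open>w\<close> at \<open>p\<close> and a section \<open>s\<close> which is smooth near \<open>p\<close>
  the covariant derivative \<open>D w s p\<close>. The value is not constrained where \<open>s\<close> is not smooth. Locality
  of \<open>D\<close> follows from the Leibniz rule. As \<open>D w s p\<close> is linear in \<open>w\<close>, it suffices to demand
  smoothness for constant vector fields \<open>w\<close>.\<close>

type_synonym 'v conn = "real \<times> real \<Rightarrow> (torus \<Rightarrow> 'v) \<Rightarrow> torus \<Rightarrow> 'v"

definition connection :: "('v::real_vector, 'n::finite) vbundle \<Rightarrow> 'v conn \<Rightarrow> bool" where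
  "connection E D \<longleftrightarrow> (\<forall>U. torus_open U \<longrightarrow>
     (\<forall>s. smooth_section E U s \<longrightarrow>
        (\<forall>w. smooth_section E U (D w s)) \<and>
        (\<forall>p\<in>U. \<forall>a b w w'. D (a *\<^sub>R w + b *\<^sub>R w') s p = a *\<^sub>R D w s p + b *\<^sub>R D w' s p) \<and>
        (\<forall>t. smooth_section E U t \<longrightarrow>
           (\<forall>p\<in>U. \<forall>w. D w (\<lambda>q. s q + t q) p = D w s p + D w t p)) \<and>
        (\<forall>f :: torus \<Rightarrow> real. torus_smooth_on U f \<longrightarrow>
           (\<forall>z\<in>pr -` U. \<forall>w. D w (\<lambda>q. f q *\<^sub>R s q) (pr z) =
              frechet_derivative (\<lambda>z. f (pr z)) (at z) w *\<^sub>R s (pr z) + f (pr z) *\<^sub>R D w s (pr z)))))"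

definition metric_connection ::
    "('v::real_vector, 'n::finite) vbundle \<Rightarrow> (torus \<Rightarrow> 'v \<Rightarrow> 'v \<Rightarrow> real) \<Rightarrow> 'v conn \<Rightarrow> bool" where
  "metric_connection E h D \<longleftrightarrow> connection E D \<and>
     (\<forall>U s t. torus_open U \<and> smooth_section E U s \<and> smooth_section E U t \<longrightarrow>
        (\<forall>z\<in>pr -` U. \<forall>w. frechet_derivative (\<lambda>z. h (pr z) (s (pr z)) (t (pr z))) (at z) w =
           h (pr z) (D w s (pr z)) (t (pr z)) + h (pr z) (s (pr z)) (D w t (pr z))))"

text \<open>Sections of the pull-back bundle along the line \<open>t \<mapsto> t w\<close> in the plane, parallel for the
  pull-back connection: locally \<open>\<xi> = \<Sum>\<^sub>i c\<^sub>i e\<^sub>i\<close> with \<open>\<Sum>\<^sub>i (c\<^sub>i' e\<^sub>i + c\<^sub>i \<nabla>\<^sub>w e\<^sub>i) = 0\<close>. The fibre of the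
  pull-back at \<open>z\<close> is \<open>fibre E (pr z)\<close>, so fibres at points differing by an element of
  \<open>2\<pi>\<int>\<^sup>2\<close> are the same set.\<close>

definition parallel_along ::
    "('v::real_vector, 'n::finite) vbundle \<Rightarrow> 'v conn \<Rightarrow> real \<times> real \<Rightarrow> (real \<Rightarrow> 'v) \<Rightarrow> bool" where
  "parallel_along E D w \<xi> \<longleftrightarrow>
     (\<forall>t. \<xi> t \<in> fibre E (pr (t *\<^sub>R w))) \<and>
     (\<forall>t. \<exists>(U, e)\<in>atlas E. pr (t *\<^sub>R w) \<in> U \<and>
        (\<exists>(c :: real \<Rightarrow> real^'n) c'.
           (\<forall>s. pr (s *\<^sub>R w) \<in> U \<longrightarrow> \<xi> s = (\<Sum>i\<in>UNIV. (c s $ i) *\<^sub>R (e (pr (s *\<^sub>R w)) $ i))) \<and>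
           (c has_vector_derivative c') (at t) \<and>
           (\<Sum>i\<in>UNIV. (c' $ i) *\<^sub>R (e (pr (t *\<^sub>R w)) $ i)
                    + (c t $ i) *\<^sub>R D w (\<lambda>p. e p $ i) (pr (t *\<^sub>R w))) = 0))"

definition holonomy_matrix ::
    "('v::real_vector, 'n::finite) vbundle \<Rightarrow> 'v conn \<Rightarrow> real \<times> real \<Rightarrow> 'v^'n \<Rightarrow> real^'n^'n \<Rightarrow> bool" where
  "holonomy_matrix E D w b A \<longleftrightarrow> rotation_matrix A \<and>
     (\<exists>\<xi> :: real \<Rightarrow> 'v^'n. \<xi> 0 = b \<and> (\<forall>i. parallel_along E D w (\<lambda>t. \<xi> t $ i)) \<and>
        (\<forall>a. \<xi> (a + 2 * pi) = row_mult (\<xi> a) A))"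

definition holonomy_generators ::
    "('v::real_vector, 'n::finite) vbundle \<Rightarrow> (torus \<Rightarrow> 'v \<Rightarrow> 'v \<Rightarrow> real) \<Rightarrow> 'v conn
       \<Rightarrow> 'v^'n \<Rightarrow> real^'n^'n \<Rightarrow> real^'n^'n \<Rightarrow> bool" where
  "holonomy_generators E h D b A\<^sub>1 A\<^sub>2 \<longleftrightarrow>
     positive_orthonormal_basis E h (pr (0, 0)) b \<and>
     holonomy_matrix E D (1, 0) b A\<^sub>1 \<and> holonomy_matrix E D (0, 1) b A\<^sub>2"

definition SO_group :: "(real^'n::finite^'n) monoid" where
  "SO_group = \<lparr>carrier = {A. rotation_matrix A}, mult = (**), one = mat 1\<rparr>"

text \<open>\<open>G\<close> is the topological holonomy group with respect to some choice of the basis at the base point;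
  other choices give conjugate subgroups.\<close>

definition topological_holonomy_group ::
    "('v::real_vector, 'n::finite) vbundle \<Rightarrow> (torus \<Rightarrow> 'v \<Rightarrow> 'v \<Rightarrow> real) \<Rightarrow> 'v conn
       \<Rightarrow> (real^'n^'n) set \<Rightarrow> bool" where
  "topological_holonomy_group E h D G \<longleftrightarrow>
     (\<exists>b A\<^sub>1 A\<^sub>2. holonomy_generators E h D b A\<^sub>1 A\<^sub>2 \<and> G = generate SO_group {A\<^sub>1, A\<^sub>2})"

instantiation "fun" :: (type, real_vector) real_vector
begin

definition scaleR_fun :: "real \<Rightarrow> ('a \<Rightarrow> 'b) \<Rightarrow> 'a \<Rightarrow> 'b" where
  "scaleR_fun a f = (\<lambda>x. a *\<^sub>R f x)"

instance
  by standard (simp_all add: scaleR_fun_def plus_fun_def fun_eq_iff algebra_simps)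

end

text \<open>Bivectors are modelled as alternating bilinear forms on the algebraic dual space. For a subspace
  \<open>F\<close>, the span of all \<open>wedge v w\<close> with \<open>v\<close> and \<open>w\<close> in \<open>F\<close> is the exterior square of \<open>F\<close>.\<close>

typedef (overloaded) 'v dual = "{\<alpha> :: 'v::real_vector \<Rightarrow> real. linear \<alpha>}"
  morphisms dual_apply Abs_dual
  by (rule exI[of _ "\<lambda>_. 0"]) (simp add: linear_iff)

type_synonym 'v bivector = "'v dual \<Rightarrow> 'v dual \<Rightarrow> real"

definition wedge :: "'v::real_vector \<Rightarrow> 'v \<Rightarrow> 'v bivector" (infixl "\<and>\<^sub>v" 70) where
  "v \<and>\<^sub>v w = (\<lambda>\<alpha> \<beta>. dual_apply \<alpha> v * dual_apply \<beta> w - dual_apply \<alpha> w * dual_apply \<beta> v)"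

definition wedge_basis :: "'v::real_vector^4 \<Rightarrow> 'v bivector^6" where
  "wedge_basis e = vector
     [e$1 \<and>\<^sub>v e$2, e$1 \<and>\<^sub>v e$3, e$1 \<and>\<^sub>v e$4, e$2 \<and>\<^sub>v e$3, e$2 \<and>\<^sub>v e$4, e$3 \<and>\<^sub>v e$4]"

definition Ext2 :: "('v::real_vector, 4) vbundle \<Rightarrow> ('v bivector, 6) vbundle" where
  "Ext2 E = \<lparr>fibre = (\<lambda>p. span {v \<and>\<^sub>v w | v w. v \<in> fibre E p \<and> w \<in> fibre E p}),
             atlas = (\<lambda>(U, e). (U, \<lambda>p. wedge_basis (e p))) ` atlas E\<rparr>"

text \<open>The induced metric and the induced connection are uniquely determined by the following
  conditions (the connection up to its irrelevant values on non-smooth sections).\<close>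

definition induced_metric ::
    "('v::real_vector, 4) vbundle \<Rightarrow> (torus \<Rightarrow> 'v \<Rightarrow> 'v \<Rightarrow> real)
       \<Rightarrow> (torus \<Rightarrow> 'v bivector \<Rightarrow> 'v bivector \<Rightarrow> real) \<Rightarrow> bool" where
  "induced_metric E h hh \<longleftrightarrow> bundle_metric (Ext2 E) hh \<and>
     (\<forall>p. \<forall>v\<in>fibre E p. \<forall>w\<in>fibre E p. \<forall>x\<in>fibre E p. \<forall>y\<in>fibre E p.
        hh p (v \<and>\<^sub>v w) (x \<and>\<^sub>v y) = h p v x * h p w y - h p v y * h p w x)"

definition induced_connection ::
    "('v::real_vector, 4) vbundle \<Rightarrow> 'v conn \<Rightarrow> 'v bivector conn \<Rightarrow> bool" where
  "induced_connection E D DD \<longleftrightarrow> connection (Ext2 E) DD \<and>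
     (\<forall>U s t. torus_open U \<and> smooth_section E U s \<and> smooth_section E U t \<longrightarrow>
        (\<forall>p\<in>U. \<forall>w. DD w (\<lambda>q. s q \<and>\<^sub>v t q) p = D w s p \<and>\<^sub>v t p + s p \<and>\<^sub>v D w t p))"

datatype eps = Eps_plus | Eps_minus

fun eps_sgn :: "eps \<Rightarrow> real" where
  "eps_sgn Eps_plus = 1"
| "eps_sgn Eps_minus = -1"

definition Omega :: "eps \<Rightarrow> 'v::real_vector^4 \<Rightarrow> 'v bivector^3" where
  "Omega \<epsilon> e = vector
     [(1 / sqrt 2) *\<^sub>R (e$1 \<and>\<^sub>v e$2 + eps_sgn \<epsilon> *\<^sub>R (e$3 \<and>\<^sub>v e$4)),
      (1 / sqrt 2) *\<^sub>R (e$1 \<and>\<^sub>v e$3 + eps_sgn \<epsilon> *\<^sub>R (e$4 \<and>\<^sub>v e$2)),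
      (1 / sqrt 2) *\<^sub>R (e$1 \<and>\<^sub>v e$4 + eps_sgn \<epsilon> *\<^sub>R (e$2 \<and>\<^sub>v e$3))]"

definition positive_orthonormal_frame ::
    "('v::real_vector, 'n::finite) vbundle \<Rightarrow> (torus \<Rightarrow> 'v \<Rightarrow> 'v \<Rightarrow> real)
       \<Rightarrow> torus set \<Rightarrow> (torus \<Rightarrow> 'v^'n) \<Rightarrow> bool" where
  "positive_orthonormal_frame E h U e \<longleftrightarrow> torus_open U \<and>
     (\<forall>i. smooth_section E U (\<lambda>p. e p $ i)) \<and> (\<forall>p\<in>U. positive_orthonormal_basis E h p (e p))"

text \<open>A subbundle of \<open>Ext2 E\<close>: the vectors \<open>Omega \<epsilon> b\<close> span the same subspace for every positively
  oriented orthonormal basis \<open>b\<close> of the fibre, and they orient it. Its sections are sections of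
  \<open>Ext2 E\<close>, so that the restriction to it of a connection of \<open>Ext2 E\<close> is that connection itself.\<close>

definition Ext2_eps ::
    "eps \<Rightarrow> ('v::real_vector, 4) vbundle \<Rightarrow> (torus \<Rightarrow> 'v \<Rightarrow> 'v \<Rightarrow> real) \<Rightarrow> ('v bivector, 3) vbundle" where
  "Ext2_eps \<epsilon> E h =
     \<lparr>fibre = (\<lambda>p. span {Omega \<epsilon> b $ i | b i. positive_orthonormal_basis E h p b}),
      atlas = {(U, \<lambda>p. Omega \<epsilon> (e p)) | U e. positive_orthonormal_frame E h U e}\<rparr>"

definition rot_C :: "real \<Rightarrow> real^3^3" where
  "rot_C \<theta> = vector
     [vector [1, 0, 0],
      vector [0, cos \<theta>, - sin \<theta>],
      vector [0, sin \<theta>, cos \<theta>]]"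

definition vec_angle :: "'a::real_inner \<Rightarrow> 'a \<Rightarrow> real" where
  "vec_angle u v = arccos (inner u v / (norm u * norm v))"

end

theory Submission
  imports Defs
begin

text \<open>Conjugation by \<open>SO(4)\<close> preserves two three-dimensional spaces of skew matrices, the self-dual and
the anti-self-dual ones. Each of them is the space of imaginary elements of an algebra of
quaternions in the 4 by 4 matrices, the two algebras commute, and every rotation of four-space is
the product of a unit element of one and a unit element of the other
(\<open>rotation_matrix_factor\<close>). Hence a closed subgroup of \<open>SO(4)\<close> is everything as soon as it contains
both groups of unit quaternions.

The holonomy of the bivectors is the holonomy of \<open>E\<close> acting by conjugation on these two spaces.
Indeed, if \<open>\<xi>\<close> and \<open>\<eta>\<close> are parallel sections of \<open>E\<close> along a line and \<open>X\<close> is a parallel bivector of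
sign \<open>\<epsilon>\<close>, then the pairing of \<open>\<xi> \<and>\<^sub>v \<eta>\<close> with \<open>X\<close> is constant
(\<open>parallel_bivector_pairing_constant\<close>). Comparing its values at the two ends of a period, with \<open>\<xi>\<close>
and \<open>\<eta>\<close> running through a parallel frame, shows that \<open>A\<^sub>j\<close> acts on the skew matrices of sign \<open>\<epsilon>\<close>
as \<open>C\<^sub>\<epsilon>\<^sub>,\<^sub>j\<close> acts on vectors, up to a linear isomorphism that is the same for both \<open>j\<close>
(\<open>holonomy_conjugation\<close>).

What remains is a statement on two rotations of four-space (\<open>closed_group_contains_rotations\<close>). As
\<open>q\<^sub>1\<close> is rational, some power of \<open>A\<^sub>1\<close> acts trivially on the self-dual matrices, so it is a unit
quaternion \<open>cos t + sin t u\<close> of the other algebra. As \<open>\<psi>\<^sub>1\<close> is irrational, no positive power of it is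
\<open>1\<close>, and by Kronecker's theorem the closure of the group contains the whole circle of all
\<open>cos s + sin s u\<close>. Conjugation by \<open>A\<^sub>2\<close> gives a second circle. It belongs to another axis, because a
rotation which maps to itself a line other than its axis is a half turn about an axis perpendicular
to that line or the identity, whereas \<open>q\<^sub>2\<close> is not an integer and the two axes are not parallel. Two
circles with different axes generate all unit quaternions (\<open>unit_quats_subset\<close>). The same argument
with the roles of \<open>A\<^sub>1\<close> and \<open>A\<^sub>2\<close> exchanged yields the unit quaternions of the first algebra.\<close>

section \<open>Two commuting quaternion algebras of 4 by 4 matrices\<close>

text \<open>For a standard basis vector \<open>v\<close> and \<open>\<sigma> = \<plusminus>1\<close> these are, up to the factor \<open>1 / sqrt 2\<close>, the
coefficient matrices of the bivectors \<open>Omega\<close> of sign \<open>\<sigma>\<close> in an orthonormal basis.\<close>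

definition kap :: "real \<Rightarrow> real^3 \<Rightarrow> real^4^4" where
  "kap \<sigma> v = vector
     [vector [0, v$1, v$2, v$3],
      vector [- v$1, 0, \<sigma> * v$3, - \<sigma> * v$2],
      vector [- v$2, - \<sigma> * v$3, 0, \<sigma> * v$1],
      vector [- v$3, \<sigma> * v$2, - \<sigma> * v$1, 0]]"

lemma vector_4 [simp]:
  fixes x y z w :: "'a::zero"
  shows "(vector [x, y, z, w] :: 'a^4) $ 1 = x" "(vector [x, y, z, w] :: 'a^4) $ 2 = y"
    "(vector [x, y, z, w] :: 'a^4) $ 3 = z" "(vector [x, y, z, w] :: 'a^4) $ 4 = w"
  unfolding vector_def by simp_all

lemma kap_entries [simp]:
  "kap \<sigma> v $ 1 $ 1 = 0" "kap \<sigma> v $ 1 $ 2 = v$1" "kap \<sigma> v $ 1 $ 3 = v$2" "kap \<sigma> v $ 1 $ 4 = v$3"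
  "kap \<sigma> v $ 2 $ 1 = - v$1" "kap \<sigma> v $ 2 $ 2 = 0" "kap \<sigma> v $ 2 $ 3 = \<sigma> * v$3" "kap \<sigma> v $ 2 $ 4 = - \<sigma> * v$2"
  "kap \<sigma> v $ 3 $ 1 = - v$2" "kap \<sigma> v $ 3 $ 2 = - \<sigma> * v$3" "kap \<sigma> v $ 3 $ 3 = 0" "kap \<sigma> v $ 3 $ 4 = \<sigma> * v$1"
  "kap \<sigma> v $ 4 $ 1 = - v$3" "kap \<sigma> v $ 4 $ 2 = \<sigma> * v$2" "kap \<sigma> v $ 4 $ 3 = - \<sigma> * v$1" "kap \<sigma> v $ 4 $ 4 = 0"
  by (simp_all add: kap_def)

lemmas mat4_simps = vec_eq_iff forall_4 matrix_matrix_mult_def sum_4 mat_def transpose_def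

lemma linear_kap: "linear (kap \<sigma>)"
  by (rule linearI) (simp_all add: mat4_simps algebra_simps)

lemma kap_0 [simp]: "kap \<sigma> 0 = 0"
  by (rule linear_0[OF linear_kap])

lemma kap_inj: "kap \<sigma> v = kap \<sigma> w \<Longrightarrow> v = w"
  by (simp add: mat4_simps forall_3)

lemma transpose_kap: "transpose (kap \<sigma> v) = - kap \<sigma> v"
  by (simp add: mat4_simps)

context
  fixes \<sigma> :: real
  assumes \<sigma>: "\<sigma> = 1 \<or> \<sigma> = -1"
begin

text \<open>Together with the real multiples of the identity the matrices of sign \<open>\<sigma>\<close> form an algebra of
quaternions, with the order of the factors reversed in case \<open>\<sigma> = 1\<close>.\<close>

lemma kap_mult: "kap \<sigma> v ** kap \<sigma> w = - (v \<bullet> w) *\<^sub>R mat 1 - \<sigma> *\<^sub>R kap \<sigma> (cross3 v w)"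
  using \<sigma> by (elim disjE) (simp_all add: mat4_simps inner_vec_def sum_3 cross3_def)

text \<open>This is the sum of the conjugates of \<open>Z\<close> by \<open>1\<close> and the three imaginary units, since the inverse of
a unit is its negative. Averaging makes it commute with the algebra of sign \<open>\<sigma>\<close>, so it has to lie
in the algebra of the opposite sign; the coefficients are read off by expansion.\<close>

lemma kap_average:
  "Z - kap \<sigma> (axis 1 1) ** Z ** kap \<sigma> (axis 1 1) - kap \<sigma> (axis 2 1) ** Z ** kap \<sigma> (axis 2 1)
     - kap \<sigma> (axis 3 1) ** Z ** kap \<sigma> (axis 3 1)
   = trace Z *\<^sub>R mat 1 + kap (-\<sigma>) (vector
       [Z$1$2 - Z$2$1 - \<sigma> * (Z$3$4 - Z$4$3), Z$1$3 - Z$3$1 - \<sigma> * (Z$4$2 - Z$2$4),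
        Z$1$4 - Z$4$1 - \<sigma> * (Z$2$3 - Z$3$2)])"
  using \<sigma> by (elim disjE) (simp_all add: mat4_simps trace_def axis_def)

end

lemma bounded_bilinear_matrix_mult: "bounded_bilinear ((**) :: real^'n^'m \<Rightarrow> real^'p^'n \<Rightarrow> real^'p^'m)"
proof -
  have "bilinear ((**) :: real^'n^'m \<Rightarrow> real^'p^'n \<Rightarrow> real^'p^'m)"
    by (auto simp: bilinear_def linear_iff matrix_matrix_mult_def vec_eq_iff sum.distrib
        sum_distrib_left algebra_simps)
  then show ?thesis by (rule bilinear_conv_bounded_bilinear[THEN iffD1])
qed

interpretation mm: bounded_bilinear "(**) :: real^'n^'m \<Rightarrow> real^'p^'n \<Rightarrow> real^'p^'m"
  by (rule bounded_bilinear_matrix_mult)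

lemmas mm_simps = mm.add_left mm.add_right mm.diff_left mm.diff_right mm.scaleR_left mm.scaleR_right
  mm.minus_left mm.minus_right matrix_mul_lid matrix_mul_rid

lemma linear_transpose: "linear (transpose :: real^'n^'m \<Rightarrow> real^'m^'n)"
  by (rule linearI) (simp_all add: transpose_def vec_eq_iff)

lemmas transpose_simps = linear_add[OF linear_transpose] linear_diff[OF linear_transpose]
   linear_cmul[OF linear_transpose] transpose_mat transpose_kap

text \<open>The usual Pfaffian if \<open>S\<close> is skew. It depends on the orientation, unlike the norm, and so it can tell
the two signs of skew matrices apart.\<close>

definition pfaffian :: "real^4^4 \<Rightarrow> real" where
  "pfaffian S = S$1$2 * S$3$4 - S$1$3 * S$2$4 + S$1$4 * S$2$3"

lemma det_4:
  "det (A::'a::comm_ring_1^4^4) =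
     A$1$1 * A$2$2 * A$3$3 * A$4$4 - A$1$1 * A$2$2 * A$3$4 * A$4$3
   - A$1$1 * A$2$3 * A$3$2 * A$4$4 + A$1$1 * A$2$3 * A$3$4 * A$4$2
   + A$1$1 * A$2$4 * A$3$2 * A$4$3 - A$1$1 * A$2$4 * A$3$3 * A$4$2
   - A$1$2 * A$2$1 * A$3$3 * A$4$4 + A$1$2 * A$2$1 * A$3$4 * A$4$3
   + A$1$2 * A$2$3 * A$3$1 * A$4$4 - A$1$2 * A$2$3 * A$3$4 * A$4$1
   - A$1$2 * A$2$4 * A$3$1 * A$4$3 + A$1$2 * A$2$4 * A$3$3 * A$4$1
   + A$1$3 * A$2$1 * A$3$2 * A$4$4 - A$1$3 * A$2$1 * A$3$4 * A$4$2
   - A$1$3 * A$2$2 * A$3$1 * A$4$4 + A$1$3 * A$2$2 * A$3$4 * A$4$1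
   + A$1$3 * A$2$4 * A$3$1 * A$4$2 - A$1$3 * A$2$4 * A$3$2 * A$4$1
   - A$1$4 * A$2$1 * A$3$2 * A$4$3 + A$1$4 * A$2$1 * A$3$3 * A$4$2
   + A$1$4 * A$2$2 * A$3$1 * A$4$3 - A$1$4 * A$2$2 * A$3$3 * A$4$1
   - A$1$4 * A$2$3 * A$3$1 * A$4$2 + A$1$4 * A$2$3 * A$3$2 * A$4$1"
proof -
  have f1234: "finite {2::4, 3, 4}" "1 \<notin> {2::4, 3, 4}"
    and f234: "finite {3::4, 4}" "2 \<notin> {3::4, 4}"
    and f34: "finite {4::4}" "3 \<notin> {4::4}"
    by auto
  show ?thesis
    unfolding det_def UNIV_4
    unfolding sum_over_permutations_insert[OF f1234]
    unfolding sum_over_permutations_insert[OF f234]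
    unfolding sum_over_permutations_insert[OF f34]
    unfolding permutes_sing
    by (simp add: sign_swap_id permutation_swap_id sign_compose sign_id swap_id_eq permutation_compose)
qed

lemma pfaffian_conj: "pfaffian (A ** kap \<sigma> v ** transpose A) = det A * pfaffian (kap \<sigma> v)"
  unfolding det_4 pfaffian_def
  by (simp add: matrix_matrix_mult_def sum_4 transpose_def) algebra

definition unit_quats :: "real \<Rightarrow> (real^4^4) set" where
  "unit_quats \<sigma> = {s *\<^sub>R mat 1 + kap \<sigma> v | s v. s\<^sup>2 + v \<bullet> v = 1}"

lemma pfaffian_kap: "pfaffian (kap \<sigma> v) = \<sigma> * (v \<bullet> v)"
  by (simp add: pfaffian_def inner_vec_def sum_3 algebra_simps)

context
  fixes \<sigma> :: real
  assumes \<sigma>: "\<sigma> = 1 \<or> \<sigma> = -1"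
begin

lemma quat_mult_conj:
  "(s *\<^sub>R mat 1 + kap \<sigma> v) ** transpose (s *\<^sub>R mat 1 + kap \<sigma> v) = (s\<^sup>2 + v \<bullet> v) *\<^sub>R mat 1"
  by (simp add: transpose_simps mm_simps kap_mult[OF \<sigma>] power2_eq_square algebra_simps)

lemma quat_conj_mult:
  "transpose (s *\<^sub>R mat 1 + kap \<sigma> v) ** (s *\<^sub>R mat 1 + kap \<sigma> v) = (s\<^sup>2 + v \<bullet> v) *\<^sub>R mat 1"
  by (simp add: transpose_simps mm_simps kap_mult[OF \<sigma>] power2_eq_square algebra_simps)

lemma quat_mult_quat:
  "(s *\<^sub>R mat 1 + kap \<sigma> v) ** (t *\<^sub>R mat 1 + kap \<sigma> w)
     = (s * t - v \<bullet> w) *\<^sub>R mat 1 + kap \<sigma> (s *\<^sub>R w + t *\<^sub>R v - \<sigma> *\<^sub>R cross3 v w)"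
  by (simp add: transpose_simps mm_simps kap_mult[OF \<sigma>] power2_eq_square algebra_simps
     linear_add[OF linear_kap] linear_diff[OF linear_kap] linear_cmul[OF linear_kap])

text \<open>For a skew matrix \<open>S\<close> the sum of the squares of the entries above the diagonal minus
\<open>2 * \<sigma> * pfaffian S\<close> is a sum of three squares, which vanishes exactly on the range of \<open>kap \<sigma>\<close>.
Rotations preserve both the norm and the Pfaffian.\<close>

lemma rotation_conj_kap:
  assumes "rotation_matrix A"
  shows "\<exists>w. A ** kap \<sigma> v ** transpose A = kap \<sigma> w"
proof -
  define S where "S = A ** kap \<sigma> v ** transpose A"
  have orth: "transpose A ** A = mat 1" "A ** transpose A = mat 1" and "det A = 1"
    using assms by (auto simp: rotation_matrix_def orthogonal_matrix_def)
  have skew: "transpose S = - S"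
    by (simp add: S_def matrix_transpose_mul matrix_mul_assoc transpose_kap mm_simps)
  have "S ** transpose S = A ** (kap \<sigma> v ** (transpose A ** A) ** transpose (kap \<sigma> v)) ** transpose A"
    by (simp add: S_def matrix_transpose_mul matrix_mul_assoc)
  also have "\<dots> = (v \<bullet> v) *\<^sub>R mat 1"
    using quat_mult_conj[of 0 v] by (simp add: orth mm_simps)
  finally have SS: "S ** transpose S = (v \<bullet> v) *\<^sub>R mat 1" .
  have pf: "pfaffian S = \<sigma> * (v \<bullet> v)"
    using \<open>det A = 1\<close> by (simp add: S_def pfaffian_conj pfaffian_kap)
  have st: "S$j$i = - S$i$j" for i j
    using arg_cong[OF skew, of "\<lambda>M. M$i$j"] by (simp add: transpose_def)
  have sk: "S$2$1 = - S$1$2" "S$3$1 = - S$1$3" "S$4$1 = - S$1$4" "S$3$2 = - S$2$3"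
    "S$4$2 = - S$2$4" "S$4$3 = - S$3$4" "S$1$1 = 0" "S$2$2 = 0" "S$3$3 = 0" "S$4$4 = 0"
    using st[of 1 1] st[of 2 2] st[of 3 3] st[of 4 4] by (auto intro: st)
  have n: "(S$1$2)\<^sup>2 + (S$1$3)\<^sup>2 + (S$1$4)\<^sup>2 = v \<bullet> v"
      "(S$1$2)\<^sup>2 + (S$2$3)\<^sup>2 + (S$2$4)\<^sup>2 = v \<bullet> v"
      "(S$1$3)\<^sup>2 + (S$2$3)\<^sup>2 + (S$3$4)\<^sup>2 = v \<bullet> v"
      "(S$1$4)\<^sup>2 + (S$2$4)\<^sup>2 + (S$3$4)\<^sup>2 = v \<bullet> v"
    using SS by (simp_all add: mat4_simps sk power2_eq_square)
  have "(S$1$2 - \<sigma> * S$3$4)\<^sup>2 + (S$1$3 + \<sigma> * S$2$4)\<^sup>2 + (S$1$4 - \<sigma> * S$2$3)\<^sup>2 = 0"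
    using \<sigma> n pf by (auto simp: pfaffian_def power2_eq_square algebra_simps)
  then have "S$1$2 = \<sigma> * S$3$4 \<and> S$1$3 = - \<sigma> * S$2$4 \<and> S$1$4 = \<sigma> * S$2$3"
    by (simp add: add_nonneg_eq_0_iff)
  then have "S = kap \<sigma> (vector [S$1$2, S$1$3, S$1$4])"
    using \<sigma> by (auto simp: vec_eq_iff forall_4 sk)
  then show ?thesis unfolding S_def by blast
qed

text \<open>A matrix which commutes with the algebra is a quarter of the sum of its four conjugates, and that sum
has the required form by the averaging formula.\<close>

lemma commutes_kap_imp_quat:
  assumes "\<And>v. B ** kap \<sigma> v = kap \<sigma> v ** B"
  shows "\<exists>s w. B = s *\<^sub>R mat 1 + kap (-\<sigma>) w"
proof -
  have "kap \<sigma> (axis i 1) ** B ** kap \<sigma> (axis i 1) = - B" for i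
    by (simp add: assms[symmetric] matrix_mul_assoc[symmetric] kap_mult[OF \<sigma>] mm_simps inner_axis_axis)
  moreover have "4 *\<^sub>R B = B - - B - - B - - B"
    by (simp add: vec_eq_iff)
  ultimately obtain t w where "4 *\<^sub>R B = t *\<^sub>R mat 1 + kap (-\<sigma>) w"
    using kap_average[OF \<sigma>, of B] by metis
  then have "(1/4) *\<^sub>R 4 *\<^sub>R B = (1/4) *\<^sub>R (t *\<^sub>R mat 1 + kap (-\<sigma>) w)"
    by (rule arg_cong)
  then have "B = (t/4) *\<^sub>R mat 1 + kap (-\<sigma>) ((1/4) *\<^sub>R w)"
    by (simp add: linear_cmul[OF linear_kap] scaleR_add_right)
  then show ?thesis by blast
qed

end

definition quats :: "real \<Rightarrow> (real^4^4) set" where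
  "quats \<sigma> = {s *\<^sub>R mat 1 + kap \<sigma> v | s v. True}"

lemma quats_add: "X \<in> quats \<sigma> \<Longrightarrow> Y \<in> quats \<sigma> \<Longrightarrow> X + Y \<in> quats \<sigma>"
proof -
  assume "X \<in> quats \<sigma>" "Y \<in> quats \<sigma>"
  then obtain s v t w where "X = s *\<^sub>R mat 1 + kap \<sigma> v" "Y = t *\<^sub>R mat 1 + kap \<sigma> w"
    by (auto simp: quats_def)
  then have "X + Y = (s + t) *\<^sub>R mat 1 + kap \<sigma> (v + w)"
    by (simp add: linear_add[OF linear_kap] scaleR_add_left)
  then show ?thesis unfolding quats_def by blast
qed

lemma quats_scaleR: "X \<in> quats \<sigma> \<Longrightarrow> c *\<^sub>R X \<in> quats \<sigma>"
proof -
  assume "X \<in> quats \<sigma>"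
  then obtain s v where "X = s *\<^sub>R mat 1 + kap \<sigma> v"
    by (auto simp: quats_def)
  then have "c *\<^sub>R X = (c * s) *\<^sub>R mat 1 + kap \<sigma> (c *\<^sub>R v)"
    by (simp add: linear_cmul[OF linear_kap] scaleR_add_right)
  then show ?thesis unfolding quats_def by blast
qed

lemma quats_diff: "X \<in> quats \<sigma> \<Longrightarrow> Y \<in> quats \<sigma> \<Longrightarrow> X - Y \<in> quats \<sigma>"
  using quats_add[of X \<sigma> "-1 *\<^sub>R Y"] quats_scaleR[of Y \<sigma> "-1"] by simp

lemma kap_in_quats: "kap \<sigma> v \<in> quats \<sigma>"
  unfolding quats_def by (metis (mono_tags, lifting) mem_Collect_eq add_0 scaleR_zero_left)

lemma one_in_quats: "mat 1 \<in> quats \<sigma>"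
  unfolding quats_def by (metis (mono_tags, lifting) mem_Collect_eq add.right_neutral scaleR_one kap_0)

lemma quats_transpose:
  assumes "X \<in> quats \<sigma>"
  shows "transpose X \<in> quats \<sigma>"
proof -
  obtain s v where "X = s *\<^sub>R mat 1 + kap \<sigma> v"
    using assms by (auto simp: quats_def)
  then have "transpose X = s *\<^sub>R mat 1 - kap \<sigma> v"
    by (simp add: transpose_simps)
  then show ?thesis
    using quats_diff[OF quats_scaleR[OF one_in_quats] kap_in_quats] by metis
qed

lemma unit_quats_subset_quats: "unit_quats \<sigma> \<subseteq> quats \<sigma>"
  by (auto simp: quats_def unit_quats_def)

context
  fixes \<sigma> :: real
  assumes \<sigma>: "\<sigma> = 1 \<or> \<sigma> = -1"
begin

lemma quats_mult: "X \<in> quats \<sigma> \<Longrightarrow> Y \<in> quats \<sigma> \<Longrightarrow> X ** Y \<in> quats \<sigma>"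
  unfolding quats_def using quat_mult_quat[OF \<sigma>] by blast

lemma unit_quats_iff: "X \<in> unit_quats \<sigma> \<longleftrightarrow> X \<in> quats \<sigma> \<and> orthogonal_matrix X"
proof
  assume "X \<in> unit_quats \<sigma>"
  then show "X \<in> quats \<sigma> \<and> orthogonal_matrix X"
    using unit_quats_subset_quats quat_conj_mult[OF \<sigma>] by (auto simp: orthogonal_matrix unit_quats_def)
next
  assume X: "X \<in> quats \<sigma> \<and> orthogonal_matrix X"
  then obtain s v where eq: "X = s *\<^sub>R mat 1 + kap \<sigma> v"
    by (auto simp: quats_def)
  have "(s\<^sup>2 + v \<bullet> v) *\<^sub>R mat 1 = (mat 1 :: real^4^4)"
    using X quat_conj_mult[OF \<sigma>, of s v] by (simp add: eq orthogonal_matrix)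
  then have "s\<^sup>2 + v \<bullet> v = 1"
    by (auto simp: vec_eq_iff forall_4 mat_def)
  then show "X \<in> unit_quats \<sigma>"
    unfolding unit_quats_def eq by blast
qed

lemma unit_quats_mult: "X \<in> unit_quats \<sigma> \<Longrightarrow> Y \<in> unit_quats \<sigma> \<Longrightarrow> X ** Y \<in> unit_quats \<sigma>"
  by (simp add: unit_quats_iff quats_mult orthogonal_matrix_mul)

lemma unit_quats_transpose: "X \<in> unit_quats \<sigma> \<Longrightarrow> transpose X \<in> unit_quats \<sigma>"
  by (simp add: unit_quats_iff quats_transpose orthogonal_matrix_transpose)

lemma quats_normalize:
  assumes "X \<in> quats \<sigma>" "X \<noteq> 0"
  obtains r where "r \<noteq> 0" "(1 / r) *\<^sub>R X \<in> unit_quats \<sigma>"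
proof -
  obtain s v where eq: "X = s *\<^sub>R mat 1 + kap \<sigma> v"
    using assms by (auto simp: quats_def)
  define r where "r = sqrt (s\<^sup>2 + v \<bullet> v)"
  have nz: "s\<^sup>2 + v \<bullet> v \<noteq> 0"
    using \<open>X \<noteq> 0\<close> by (auto simp: eq add_nonneg_eq_0_iff)
  have r2: "r\<^sup>2 = s\<^sup>2 + v \<bullet> v" by (simp add: r_def)
  then have "r \<noteq> 0" using nz by auto
  have XX: "transpose X ** X = r\<^sup>2 *\<^sub>R mat 1"
    unfolding eq quat_conj_mult[OF \<sigma>] r2 ..
  have "transpose ((1 / r) *\<^sub>R X) ** ((1 / r) *\<^sub>R X) = mat 1"
    using \<open>r \<noteq> 0\<close> by (simp add: linear_cmul[OF linear_transpose] mm_simps XX power2_eq_square)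
  then have "(1 / r) *\<^sub>R X \<in> unit_quats \<sigma>"
    by (simp add: unit_quats_iff quats_scaleR assms orthogonal_matrix)
  with \<open>r \<noteq> 0\<close> show ?thesis by (rule that)
qed

text \<open>In the quaternions, \<open>x + i x i\<^sup>-\<^sup>1 + j x j\<^sup>-\<^sup>1 + k x k\<^sup>-\<^sup>1\<close> is four times the real part of \<open>x\<close>.\<close>

lemma kap_average_kap:
  "kap \<sigma> v - kap \<sigma> (axis 1 1) ** kap \<sigma> v ** kap \<sigma> (axis 1 1)
     - kap \<sigma> (axis 2 1) ** kap \<sigma> v ** kap \<sigma> (axis 2 1)
     - kap \<sigma> (axis 3 1) ** kap \<sigma> v ** kap \<sigma> (axis 3 1) = 0"
  unfolding kap_average[OF \<sigma>] using \<sigma> by (auto simp: vec_eq_iff forall_4 trace_def sum_4)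

end

text \<open>A form of the Skolem-Noether theorem. With \<open>J\<close> the conjugates by \<open>Y\<close> of the imaginary units \<open>I\<close>, the
average \<open>m\<close> of \<open>transpose Y ** x\<close> is a quaternion of sign \<open>-\<sigma>\<close>, and \<open>Y ** m\<close> is the difference of
\<open>x\<close> and the three products \<open>J ** x ** I\<close>, hence a quaternion of sign \<open>\<sigma>\<close>. This is the factorization,
once \<open>x\<close> is found with \<open>m \<noteq> 0\<close>. If \<open>1\<close> and the imaginary units all failed, then the four equations
\<open>m = 0\<close> would add up to \<open>4 = 0\<close>.\<close>

lemma rotation_matrix_factor:
  assumes \<sigma>: "\<sigma> = 1 \<or> \<sigma> = -1" and "rotation_matrix Y"
  obtains X Z where "X \<in> unit_quats \<sigma>" "Z \<in> unit_quats (-\<sigma>)" "Y = X ** Z"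
proof -
  have \<sigma>': "-\<sigma> = 1 \<or> -\<sigma> = -1" using \<sigma> by auto
  have orth: "transpose Y ** Y = mat 1" "Y ** transpose Y = mat 1"
    using assms by (auto simp: rotation_matrix_def orthogonal_matrix_def)
  define I where "I i = kap \<sigma> (axis i 1)" for i :: 3
  define J where "J i = Y ** I i ** transpose Y" for i
  define avg where "avg M = M - I 1 ** M ** I 1 - I 2 ** M ** I 2 - I 3 ** M ** I 3" for M
  have Jq: "J i \<in> quats \<sigma>" for i
    using rotation_conj_kap[OF assms] kap_in_quats by (metis I_def J_def)
  have Iq: "I i \<in> quats \<sigma>" for i
    by (simp add: I_def kap_in_quats)
  have avgq: "avg M \<in> quats (-\<sigma>)" for M
    unfolding avg_def I_def kap_average[OF \<sigma>] quats_def by blast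
  have YI: "Y ** I i = J i ** Y" for i
    by (simp add: J_def matrix_mul_assoc[symmetric] orth)
  have Yavg: "Y ** avg (transpose Y ** x) = x - J 1 ** x ** I 1 - J 2 ** x ** I 2 - J 3 ** x ** I 3" for x
    unfolding avg_def J_def mm.diff_right matrix_mul_assoc orth matrix_mul_lid ..
  have avgI: "avg (I i) = 0" for i
    unfolding avg_def I_def by (rule kap_average_kap[OF \<sigma>])
  have II: "I i ** I i = - mat 1" for i
    by (simp add: I_def kap_mult[OF \<sigma>] inner_axis_axis)
  have "\<exists>x. x \<in> quats \<sigma> \<and> avg (transpose Y ** x) \<noteq> 0"
  proof (rule ccontr)
    assume "\<not> ?thesis"
    then have z: "x = J 1 ** x ** I 1 + J 2 ** x ** I 2 + J 3 ** x ** I 3" if "x \<in> quats \<sigma>" for x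
      using Yavg[of x] that by (simp add: algebra_simps)
    have 1: "mat 1 = J 1 ** I 1 + J 2 ** I 2 + J 3 ** I 3"
      using z[OF one_in_quats] by simp
    \<comment> \<open>the equation z for I k, multiplied by I k from the right\<close>
  have 2: "mat 1 = - (J 1 ** (I k ** I 1 ** I k) + J 2 ** (I k ** I 2 ** I k) + J 3 ** (I k ** I 3 ** I k))"
      (is "_ = - ?S") for k
    proof -
      have "?S = (J 1 ** I k ** I 1 + J 2 ** I k ** I 2 + J 3 ** I k ** I 3) ** I k"
        by (simp add: mm_simps matrix_mul_assoc)
      also have "\<dots> = I k ** I k"
        using z[OF Iq[of k]] by simp
      finally show ?thesis by (simp add: II)
    qed
    have "4 *\<^sub>R mat 1 = mat 1 + mat 1 + mat 1 + (mat 1 :: real^4^4)"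
      by (simp add: vec_eq_iff)
    also have "\<dots> = J 1 ** avg (I 1) + J 2 ** avg (I 2) + J 3 ** avg (I 3)"
      (is "_ = ?R")
    proof -
      define S where "S k = J 1 ** (I k ** I 1 ** I k) + J 2 ** (I k ** I 2 ** I k)
        + J 3 ** (I k ** I 3 ** I k)" for k
      have "S k = - mat 1" for k
        using 2[of k] by (simp add: S_def)
      moreover have "?R = (J 1 ** I 1 + J 2 ** I 2 + J 3 ** I 3) - S 1 - S 2 - S 3"
        unfolding avg_def S_def mm.diff_right by (simp add: algebra_simps)
      ultimately show ?thesis by (simp add: 1[symmetric])
    qed
    finally have "4 *\<^sub>R mat 1 = (0 :: real^4^4)" by (simp add: avgI)
    from arg_cong[OF this, of "\<lambda>M. M $ 1 $ 1"] show False by (simp add: mat_def)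
  qed
  then obtain x where x: "x \<in> quats \<sigma>" "avg (transpose Y ** x) \<noteq> 0" by blast
  define m where "m = avg (transpose Y ** x)"
  define p where "p = Y ** m"
  have pq: "p \<in> quats \<sigma>"
    unfolding p_def m_def Yavg by (intro quats_diff quats_mult[OF \<sigma>] x Jq Iq)
  have "m \<in> quats (-\<sigma>)" "m \<noteq> 0"
    using x avgq by (simp_all add: m_def)
  then obtain r where r: "r \<noteq> 0" "(1 / r) *\<^sub>R m \<in> unit_quats (-\<sigma>)"
    using quats_normalize[OF \<sigma>'] by blast
  define Z where "Z = (1 / r) *\<^sub>R m"
  have Z: "Z \<in> unit_quats (-\<sigma>)" "orthogonal_matrix Z"
    using r by (simp_all add: Z_def unit_quats_iff[OF \<sigma>'])
  have YZ: "(1 / r) *\<^sub>R p = Y ** Z"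
    by (simp add: p_def Z_def mm_simps)
  have "orthogonal_matrix Y"
    using assms(2) by (simp add: rotation_matrix_def)
  with Z have "Y ** Z \<in> unit_quats \<sigma>"
    by (simp add: unit_quats_iff[OF \<sigma>] YZ[symmetric] quats_scaleR pq)
       (simp add: YZ orthogonal_matrix_mul)
  moreover have "transpose Z \<in> unit_quats (-\<sigma>)"
    by (rule unit_quats_transpose[OF \<sigma>' Z(1)])
  moreover have "Y = (Y ** Z) ** transpose Z"
    using Z(2) by (simp add: matrix_mul_assoc[symmetric] orthogonal_matrix_def)
  ultimately show ?thesis by (rule that)
qed

section \<open>Closed groups containing circles of unit quaternions\<close>

definition quat_circle :: "real \<Rightarrow> real^3 \<Rightarrow> real \<Rightarrow> real^4^4" where
  "quat_circle \<sigma> u t = cos t *\<^sub>R mat 1 + sin t *\<^sub>R kap \<sigma> u"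

primrec matpow :: "real^'n^'n \<Rightarrow> nat \<Rightarrow> real^'n^'n" where
  "matpow A 0 = mat 1"
| "matpow A (Suc n) = A ** matpow A n"

lemma matpow_add: "matpow A (m + n) = matpow A m ** matpow A n"
  by (induction m) (simp_all add: matrix_mul_assoc)

lemma matpow_mult: "matpow A (m * n) = matpow (matpow A m) n"
  by (induction n) (simp_all add: matpow_add)

lemma orthogonal_matrix_matpow: "orthogonal_matrix A \<Longrightarrow> orthogonal_matrix (matpow A n)"
  by (induction n) (simp_all add: orthogonal_matrix_mul orthogonal_matrix_id)

lemma matpow_conj:
  assumes "\<And>v. A ** kap \<sigma> (P v) ** transpose A = kap \<sigma> (P (C *v v))"
  shows "matpow A n ** kap \<sigma> (P v) ** transpose (matpow A n) = kap \<sigma> (P (matpow C n *v v))"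
proof (induction n)
  case (Suc n)
  have "matpow A (Suc n) ** kap \<sigma> (P v) ** transpose (matpow A (Suc n))
    = A ** (matpow A n ** kap \<sigma> (P v) ** transpose (matpow A n)) ** transpose A"
    by (simp add: matrix_transpose_mul matrix_mul_assoc)
  then show ?case by (simp add: Suc assms matrix_vector_mul_assoc)
qed simp

lemma inner_matrix_mult_left:
  "((A :: real^'n^'m) ** (B :: real^'p^'n)) \<bullet> C = B \<bullet> (transpose A ** C)"
proof -
  have "(A ** B) \<bullet> C = (\<Sum>i\<in>UNIV. \<Sum>j\<in>UNIV. \<Sum>k\<in>UNIV. A$i$k * B$k$j * C$i$j)"
    by (simp add: inner_vec_def matrix_matrix_mult_def sum_distrib_right)
  also have "\<dots> = (\<Sum>i\<in>UNIV. \<Sum>k\<in>UNIV. \<Sum>j\<in>UNIV. A$i$k * B$k$j * C$i$j)"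
    by (intro sum.cong sum.swap refl)
  also have "\<dots> = (\<Sum>k\<in>UNIV. \<Sum>i\<in>UNIV. \<Sum>j\<in>UNIV. A$i$k * B$k$j * C$i$j)"
    by (rule sum.swap)
  also have "\<dots> = (\<Sum>k\<in>UNIV. \<Sum>j\<in>UNIV. \<Sum>i\<in>UNIV. A$i$k * B$k$j * C$i$j)"
    by (intro sum.cong sum.swap refl)
  also have "\<dots> = B \<bullet> (transpose A ** C)"
    by (simp add: inner_vec_def matrix_matrix_mult_def sum_distrib_left transpose_def algebra_simps)
  finally show ?thesis .
qed

lemma no_first_order_term:
  fixes \<alpha> \<beta> :: real
  assumes "\<And>t. cos t * \<alpha> + sin t * \<beta> \<le> \<alpha>"
  shows "\<beta> = 0"
proof (rule DERIV_local_max[of "\<lambda>t. cos t * \<alpha> + sin t * \<beta>" \<beta> 0 1])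
  show "((\<lambda>t. cos t * \<alpha> + sin t * \<beta>) has_real_derivative \<beta>) (at 0)"
    by (auto intro!: derivative_eq_intros)
qed (use assms in auto)

lemma quat_circle_conj:
  assumes "orthogonal_matrix A" "A ** kap \<sigma> v ** transpose A = kap \<sigma> w"
  shows "A ** quat_circle \<sigma> v t ** transpose A = quat_circle \<sigma> w t"
  using assms by (simp add: quat_circle_def mm_simps orthogonal_matrix_def)

context
  fixes \<sigma> :: real
  assumes \<sigma>: "\<sigma> = 1 \<or> \<sigma> = -1"
begin

lemma conj_kap_norm:
  assumes "orthogonal_matrix A" "A ** kap \<sigma> v ** transpose A = kap \<sigma> w"
  shows "w \<bullet> w = v \<bullet> v"
proof -
  have o: "transpose A ** A = mat 1" "A ** transpose A = mat 1"
    using assms by (auto simp: orthogonal_matrix_def)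
  have "- (w \<bullet> w) *\<^sub>R mat 1 = kap \<sigma> w ** kap \<sigma> w"
    by (simp add: kap_mult[OF \<sigma>])
  also have "\<dots> = A ** (kap \<sigma> v ** (transpose A ** A) ** kap \<sigma> v) ** transpose A"
    by (simp add: assms(2)[symmetric] matrix_mul_assoc)
  also have "\<dots> = - (v \<bullet> v) *\<^sub>R mat 1"
    by (simp add: o kap_mult[OF \<sigma>] mm_simps)
  finally show ?thesis by (simp add: vec_eq_iff forall_4 mat_def)
qed

lemma quat_circle_in_unit_quats: "u \<bullet> u = 1 \<Longrightarrow> quat_circle \<sigma> u t \<in> unit_quats \<sigma>"
  unfolding quat_circle_def unit_quats_def
  by (intro CollectI exI[of _ "cos t"] exI[of _ "sin t *\<^sub>R u"])
     (simp add: linear_cmul[OF linear_kap] power2_eq_square[symmetric])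

lemma quat_circle_add: "u \<bullet> u = 1 \<Longrightarrow> quat_circle \<sigma> u s ** quat_circle \<sigma> u t = quat_circle \<sigma> u (s + t)"
  by (simp add: quat_circle_def mm_simps kap_mult[OF \<sigma>] cos_add sin_add algebra_simps)

lemma matpow_quat_circle: "u \<bullet> u = 1 \<Longrightarrow> matpow (quat_circle \<sigma> u t) n = quat_circle \<sigma> u (real n * t)"
  by (induction n) (simp_all add: quat_circle_add algebra_simps, simp add: quat_circle_def)

lemma compact_unit_quats: "compact (unit_quats \<sigma>)"
proof -
  have "unit_quats \<sigma> = (\<lambda>(s, v). s *\<^sub>R mat 1 + kap \<sigma> v) ` sphere 0 1"
    by (force simp: unit_quats_def norm_Pair dot_square_norm image_iff)
  moreover have "continuous_on (sphere 0 1) (\<lambda>(s, v). s *\<^sub>R mat 1 + kap \<sigma> v)"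
  proof -
    have "bounded_linear (kap \<sigma>)"
      using linear_kap by (simp add: linear_conv_bounded_linear)
    then show ?thesis
      unfolding case_prod_unfold
      by (intro continuous_intros bounded_linear.continuous_on[of "kap \<sigma>"])
  qed
  ultimately show ?thesis
    using compact_continuous_image compact_sphere by metis
qed

text \<open>Conjugation by \<open>quat_circle \<sigma> u t\<close> rotates the imaginary quaternions about \<open>u\<close> by the angle \<open>2 * t\<close>. A
right angle moves \<open>w\<close> out of the plane of \<open>u\<close> and \<open>w\<close>, which supplies a third independent axis.\<close>

lemma quarter_turn_conj:
  assumes "u \<bullet> u = 1"
  shows "quat_circle \<sigma> u (pi/4) ** kap \<sigma> w ** transpose (quat_circle \<sigma> u (pi/4))
       = kap \<sigma> ((u \<bullet> w) *\<^sub>R u - \<sigma> *\<^sub>R cross3 u w)"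
proof -
  have c: "quat_circle \<sigma> u (pi/4) = (sqrt 2 / 2) *\<^sub>R (mat 1 + kap \<sigma> u)"
    by (simp add: quat_circle_def cos_45 sin_45 scaleR_add_right)
  have cc: "cross3 (cross3 u w) u = w - (u \<bullet> w) *\<^sub>R u"
    using assms cross_skew[of "cross3 u w" u] Lagrange[of u u w] by simp
  have sw: "cross3 w u = - cross3 u w" by (rule cross_skew)
  have "(mat 1 + kap \<sigma> u) ** kap \<sigma> w ** transpose (mat 1 + kap \<sigma> u)
    = 2 *\<^sub>R kap \<sigma> ((u \<bullet> w) *\<^sub>R u - \<sigma> *\<^sub>R cross3 u w)"
    using \<sigma> assms
    by (auto simp: transpose_simps mm_simps kap_mult[OF \<sigma>] cc sw dot_cross_self inner_commute algebra_simps scaleR_2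
      linear_add[OF linear_kap] linear_diff[OF linear_kap] linear_cmul[OF linear_kap] linear_neg[OF linear_kap])
       (simp_all add: vec_eq_iff)
  then show ?thesis
    by (simp add: c linear_cmul[OF linear_transpose] mm_simps)
qed

text \<open>By Kronecker's approximation theorem the multiples of \<open>t\<close> are dense modulo \<open>2 * pi\<close>.\<close>

lemma irrational_circle_dense:
  assumes u: "u \<bullet> u = 1" and K: "closed K" and pow: "\<And>n. quat_circle \<sigma> u (real n * t) \<in> K"
    and irr: "t / (2 * pi) \<notin> \<rat>"
  shows "quat_circle \<sigma> u s \<in> K"
proof -
  define T where "T = quat_circle \<sigma> u -` K"
  have "continuous_on UNIV (quat_circle \<sigma> u)"
    unfolding quat_circle_def by (intro continuous_intros)
  then have "closed T"
    unfolding T_def using K by (simp add: continuous_on_closed_vimage)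
  moreover have "s \<in> closure T"
    unfolding closure_approachable
  proof (intro allI impI)
    fix e :: real assume "e > 0"
    then have "e / (2 * pi) > 0" by simp
    then obtain h k where hk: "k > 0" "\<bar>of_int k * (t / (2*pi)) - of_int h - s / (2*pi)\<bar> < e / (2*pi)"
      using sequence_of_fractional_parts_is_dense[OF irr, of "e / (2*pi)" "s / (2*pi)"] by blast
    \<comment> \<open>a point of the circle that differs from k t by full turns and is close to s\<close>
    define \<tau> where "\<tau> = real (nat k) * t + - of_int h * (2 * pi)"
    have "\<tau> - s = (2 * pi) * (of_int k * (t / (2*pi)) - of_int h - s / (2*pi))"
      using \<open>k > 0\<close> by (simp add: \<tau>_def field_simps)
    then have "\<bar>\<tau> - s\<bar> < e"
      using mult_strict_left_mono[OF hk(2), of "2 * pi"] by (simp add: abs_mult)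
    moreover have "quat_circle \<sigma> u \<tau> = quat_circle \<sigma> u (real (nat k) * t)"
      using sin.plus_of_int[of "real (nat k) * t" "-h"] cos.plus_of_int[of "real (nat k) * t" "-h"]
      by (simp add: quat_circle_def \<tau>_def)
    ultimately show "\<exists>y\<in>T. dist y s < e"
      using pow by (intro bexI[of _ \<tau>]) (auto simp: T_def dist_real_def)
  qed
  ultimately show ?thesis
    by (simp add: T_def)
qed

text \<open>Let \<open>X\<close> be a point of the unit quaternions in \<open>K\<close> which is closest to a given unit quaternion \<open>Y\<close>. If
\<open>K\<close> contains the circle with axis \<open>a\<close>, then \<open>X\<close> can be moved along that circle, so the first order
term of the distance vanishes and the imaginary part of \<open>transpose X ** Y\<close> is orthogonal to \<open>a\<close>. This
holds for \<open>u\<close>, for \<open>w\<close> and for the image of \<open>w\<close> under a quarter turn about \<open>u\<close>, which span the space. So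
\<open>transpose X ** Y\<close> is real, that is \<open>Y = X\<close> or \<open>Y = - X\<close>, and \<open>-1\<close> lies on the circles.\<close>

lemma unit_quats_subset:
  assumes K: "closed K" and mult: "\<And>X Y. X \<in> K \<Longrightarrow> Y \<in> K \<Longrightarrow> X ** Y \<in> K"
    and u: "u \<bullet> u = 1" "\<And>t. quat_circle \<sigma> u t \<in> K"
    and w: "w \<bullet> w = 1" "\<And>t. quat_circle \<sigma> w t \<in> K"
    and uw: "cross3 u w \<noteq> 0"
  shows "unit_quats \<sigma> \<subseteq> K"
proof
  fix Y assume Y: "Y \<in> unit_quats \<sigma>"
  let ?S = "unit_quats \<sigma> \<inter> K"
  have "mat 1 = quat_circle \<sigma> u 0" by (simp add: quat_circle_def)
  then have "mat 1 \<in> ?S"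
    using u quat_circle_in_unit_quats[OF u(1), of 0] by simp
  moreover have "compact ?S"
    using K compact_unit_quats by (simp add: compact_Int_closed)
  ultimately obtain X where X: "X \<in> ?S" "\<And>Z. Z \<in> ?S \<Longrightarrow> Z \<bullet> Y \<le> X \<bullet> Y"
    using continuous_attains_sup[of ?S "\<lambda>X. X \<bullet> Y", OF _ _ continuous_on_inner[OF continuous_on_id continuous_on_const]]
    by blast
  have "transpose X ** Y \<in> quats \<sigma>"
    using X Y by (auto simp: unit_quats_iff[OF \<sigma>] quats_transpose quats_mult[OF \<sigma>])
  then obtain s v where sv: "transpose X ** Y = s *\<^sub>R mat 1 + kap \<sigma> v"
    by (auto simp: quats_def)
  have orth: "a \<bullet> v = 0" if "a \<bullet> a = 1" "\<And>t. quat_circle \<sigma> a t \<in> K" for a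
  proof -
    have "(X ** kap \<sigma> a) \<bullet> Y = 0"
    proof (rule no_first_order_term)
      fix t
      have "X ** quat_circle \<sigma> a t \<in> ?S"
        using X that mult unit_quats_mult[OF \<sigma>] quat_circle_in_unit_quats by auto
      then have "(X ** quat_circle \<sigma> a t) \<bullet> Y \<le> X \<bullet> Y" by (rule X)
      then show "cos t * (X \<bullet> Y) + sin t * ((X ** kap \<sigma> a) \<bullet> Y) \<le> X \<bullet> Y"
        by (simp add: quat_circle_def mm_simps inner_add_left)
    qed
    then have "kap \<sigma> a \<bullet> (s *\<^sub>R mat 1 + kap \<sigma> v) = 0"
      by (simp add: inner_matrix_mult_left sv)
    moreover have "kap \<sigma> a \<bullet> (s *\<^sub>R mat 1 + kap \<sigma> v) = 4 * (a \<bullet> v)"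
      using \<sigma> by (auto simp: inner_vec_def sum_4 sum_3 mat_def)
    ultimately show ?thesis by simp
  qed
  \<comment> \<open>conjugation by h is the quarter turn about u, as rotation angles are doubled\<close>
  define h where "h = quat_circle \<sigma> u (pi/4)"
  define x where "x = (u \<bullet> w) *\<^sub>R u - \<sigma> *\<^sub>R cross3 u w"
  have h: "orthogonal_matrix h"
    using quat_circle_in_unit_quats[OF u(1)] unit_quats_iff[OF \<sigma>] by (auto simp: h_def)
  have hK: "h \<in> K" "transpose h \<in> K"
    using u(2)[of "pi/4"] u(2)[of "-pi/4"] by (simp_all add: h_def quat_circle_def transpose_simps)
  have hx: "h ** kap \<sigma> w ** transpose h = kap \<sigma> x"
    unfolding h_def x_def by (rule quarter_turn_conj[OF u(1)])
  have "quat_circle \<sigma> x t \<in> K" for t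
    unfolding quat_circle_conj[OF h hx, symmetric] by (intro mult hK w)
  moreover have "x \<bullet> x = 1"
    using conj_kap_norm[OF h hx] w by simp
  ultimately have "x \<bullet> v = 0" by (intro orth)
  moreover have uv: "u \<bullet> v = 0" "w \<bullet> v = 0"
    using orth u w by auto
  ultimately have "cross3 u w \<bullet> v = 0"
    using \<sigma> by (auto simp: x_def inner_diff_left inner_add_left)
  moreover have "cross3 (cross3 u w) v = 0"
    using uv cross_skew[of "cross3 u w" v] Lagrange[of v u w] by (simp add: inner_commute)
  ultimately have "v = 0"
    using uw norm_and_cross_eq_0 by blast
  then have XY: "transpose X ** Y = s *\<^sub>R mat 1"
    by (simp add: sv)
  have oX: "orthogonal_matrix X" and oY: "orthogonal_matrix Y"
    using X Y by (auto simp: unit_quats_iff[OF \<sigma>])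
  have "Y = X ** (transpose X ** Y)"
    using oX by (simp add: matrix_mul_assoc orthogonal_matrix_def)
  then have YX: "Y = s *\<^sub>R X"
    by (simp add: XY mm_simps)
  have "s\<^sup>2 *\<^sub>R mat 1 = (mat 1 :: real^4^4)"
    using oX oY by (simp add: YX orthogonal_matrix linear_cmul[OF linear_transpose] mm_simps power2_eq_square)
  then have "s\<^sup>2 = 1"
    by (simp add: vec_eq_iff forall_4 mat_def)
  then have "s = 1 \<or> s = -1" by (simp add: power2_eq_1_iff)
  moreover have "X ** quat_circle \<sigma> u pi \<in> K"
    using X u mult by auto
  ultimately show "Y \<in> K"
    using X by (auto simp: YX quat_circle_def mm_simps)
qed

end

text \<open>The rotation \<open>A\<close> acts by \<open>C\<close> on the imaginary quaternions of sign \<open>-\<sigma>\<close> and by \<open>R\<close> on those of sign \<open>\<sigma>\<close>,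
in coordinates \<open>P\<close> and \<open>Q\<close>. A power of \<open>A\<close> acts trivially on the former, so it commutes with them and
is a unit quaternion of sign \<open>\<sigma>\<close>. Its imaginary part is invariant under conjugation by it, so it lies
on the axis \<open>f\<close> of \<open>R\<close>.
Having infinite order it generates a dense subgroup of a circle, and \<open>B\<close>, which acts by \<open>R'\<close> and moves
the axis, carries that circle to another one.\<close>

lemma unit_quats_in_closed_group:
  fixes P Q :: "real^3 \<Rightarrow> real^3"
  assumes \<sigma>: "\<sigma> = 1 \<or> \<sigma> = -1"
    and K: "closed K" "mat 1 \<in> K" and mult: "\<And>X Y. X \<in> K \<Longrightarrow> Y \<in> K \<Longrightarrow> X ** Y \<in> K"
    and A: "A \<in> K" "orthogonal_matrix A"
    and B: "B \<in> K" "transpose B \<in> K" "orthogonal_matrix B"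
    and P: "surj P" "\<And>v. A ** kap (-\<sigma>) (P v) ** transpose A = kap (-\<sigma>) (P (C *v v))"
    and Q: "linear Q" "inj Q" "\<And>v. A ** kap \<sigma> (Q v) ** transpose A = kap \<sigma> (Q (R *v v))"
      "\<And>v. B ** kap \<sigma> (Q v) ** transpose B = kap \<sigma> (Q (R' *v v))"
    and C: "N > 0" "matpow C N = mat 1"
    and R: "\<And>m v. m > 0 \<Longrightarrow> matpow R m *v v = v \<Longrightarrow> \<exists>r. v = r *\<^sub>R f"
    and R': "\<And>r. R' *v f \<noteq> r *\<^sub>R f"
  shows "unit_quats \<sigma> \<subseteq> K"
proof -
  have \<sigma>': "-\<sigma> = 1 \<or> -\<sigma> = -1" using \<sigma> by auto
  define X where "X = matpow A N"
  have oX: "orthogonal_matrix X"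
    unfolding X_def by (rule orthogonal_matrix_matpow[OF A(2)])
  have powK: "matpow A n \<in> K" for n
    by (induction n) (simp_all add: K A mult)
  \<comment> \<open>X acts trivially on the quaternions of sign -\<sigma>, that is, it commutes with them\<close>
  have "X ** kap (-\<sigma>) v = kap (-\<sigma>) v ** X" for v
  proof -
    obtain v0 where "v = P v0" using P(1) by (metis surjD)
    then have "X ** kap (-\<sigma>) v ** transpose X = kap (-\<sigma>) v"
      using matpow_conj[of A "-\<sigma>" P C N v0, OF P(2)] by (simp add: X_def C)
    then have "kap (-\<sigma>) v ** X = X ** kap (-\<sigma>) v ** (transpose X ** X)"
      by (simp add: matrix_mul_assoc)
    then show ?thesis using oX by (simp add: orthogonal_matrix_def)
  qed
  then have "\<exists>s v. X = s *\<^sub>R mat 1 + kap (- (-\<sigma>)) v"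
    by (rule commutes_kap_imp_quat[OF \<sigma>'])
  then have "X \<in> quats \<sigma>" by (auto simp: quats_def)
  with oX have "X \<in> unit_quats \<sigma>" by (simp add: unit_quats_iff[OF \<sigma>])
  then obtain s v where X: "X = s *\<^sub>R mat 1 + kap \<sigma> v" and sv: "s\<^sup>2 + v \<bullet> v = 1"
    by (auto simp: unit_quats_def)
  have "X ** kap \<sigma> v = kap \<sigma> v ** X"
    unfolding X mm.add_left mm.add_right mm.scaleR_left mm.scaleR_right by simp
  then have "X ** kap \<sigma> v ** transpose X = kap \<sigma> v"
    using oX by (simp add: matrix_mul_assoc[symmetric] orthogonal_matrix_def)
  moreover obtain v0 where v0: "v = Q v0"
    using linear_injective_imp_surjective[OF Q(1,2)] by (metis surjD)
  ultimately have "kap \<sigma> (Q (matpow R N *v v0)) = kap \<sigma> (Q v0)"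
    using matpow_conj[of A \<sigma> Q R N v0, OF Q(3)] by (simp add: X_def)
  then have "matpow R N *v v0 = v0"
    using Q(2) by (auto dest: kap_inj injD)
  then obtain r where "v0 = r *\<^sub>R f" using R C(1) by blast
  then have v: "v = r *\<^sub>R Q f" by (simp add: v0 linear_cmul[OF Q(1)])
  have "f \<noteq> 0" using R'[of 0] by auto
  then have Qf: "Q f \<noteq> 0"
    using Q(1,2) linear_injective_0 by blast
  define u where "u = (1 / norm (Q f)) *\<^sub>R Q f"
  have u1: "u \<bullet> u = 1"
    using Qf by (simp add: u_def dot_square_norm power2_eq_square)
  have vu: "v = (r * norm (Q f)) *\<^sub>R u"
    using Qf by (simp add: v u_def)
  then have "s\<^sup>2 + (r * norm (Q f))\<^sup>2 = 1"
    using sv u1 by (simp add: power2_eq_square)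
  then obtain t where t: "s = cos t" "r * norm (Q f) = sin t"
    by (metis sincos_total_2pi)
  have Xc: "X = quat_circle \<sigma> u t"
    by (simp add: X quat_circle_def vu t linear_cmul[OF linear_kap])
  have "quat_circle \<sigma> u (real n * t) \<in> K" for n
    using powK[of "N * n"] by (simp add: matpow_mult X_def[symmetric] matpow_quat_circle[OF \<sigma> u1, symmetric] Xc[symmetric])
  moreover have "t / (2 * pi) \<notin> \<rat>"
  proof
    assume "t / (2 * pi) \<in> \<rat>"
    then obtain p q :: int where pq: "q > 0" "t / (2 * pi) = of_int p / of_int q"
      by (meson Rats_cases')
    then have "real (nat q) * t = 0 + of_int p * (2 * pi)"
      by (simp add: field_simps)
    then have "matpow X (nat q) = mat 1"
      unfolding Xc matpow_quat_circle[OF \<sigma> u1]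
      using sin.plus_of_int[of "0::real" p] cos.plus_of_int[of "0::real" p] by (simp add: quat_circle_def)
    then have one: "matpow A (N * nat q) = mat 1"
      by (simp add: matpow_mult X_def)
    have pos: "N * nat q > 0" using C(1) pq(1) by simp
    have "kap \<sigma> (Q (matpow R (N * nat q) *v (R' *v f))) = kap \<sigma> (Q (R' *v f))"
      using matpow_conj[of A \<sigma> Q R "N * nat q", OF Q(3)] by (simp add: one)
    then have "matpow R (N * nat q) *v (R' *v f) = R' *v f"
      using Q(2) by (auto dest: kap_inj injD)
    then show False using R[OF pos] R' by blast
  qed
  ultimately have uK: "quat_circle \<sigma> u s \<in> K" for s
    using irrational_circle_dense[OF \<sigma> u1 K(1)] by blast
  \<comment> \<open>the axis of the circle obtained from the first one by conjugation with B\<close>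
  define w where "w = (1 / norm (Q f)) *\<^sub>R Q (R' *v f)"
  have w: "B ** kap \<sigma> u ** transpose B = kap \<sigma> w"
    using Q(4)[of f] by (simp add: u_def w_def linear_cmul[OF linear_kap] mm_simps)
  have w1: "w \<bullet> w = 1"
    using conj_kap_norm[OF \<sigma> B(3) w] u1 by simp
  have wK: "quat_circle \<sigma> w s \<in> K" for s
    unfolding quat_circle_conj[OF B(3) w, symmetric] by (intro mult B uK)
  have "cross3 u w \<noteq> 0"
  proof
    assume "cross3 u w = 0"
    moreover have "u \<noteq> 0" "w \<noteq> 0" using u1 w1 by auto
    ultimately obtain c where "w = c *\<^sub>R u"
      by (auto simp: cross_eq_0 collinear_lemma)
    then have "norm (Q f) *\<^sub>R w = norm (Q f) *\<^sub>R c *\<^sub>R u" by simp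
    then have "Q (R' *v f) = Q (c *\<^sub>R f)"
      using Qf by (simp add: u_def w_def linear_cmul[OF Q(1)])
    then show False using Q(2) R' by (auto dest: injD)
  qed
  then show ?thesis
    using unit_quats_subset[OF \<sigma> K(1) mult u1 uK w1 wK] by blast
qed

section \<open>Rotations of three-space and the density criterion\<close>

lemma rot_C_mult_vec: "rot_C \<theta> *v v = vector [v$1, cos \<theta> * v$2 - sin \<theta> * v$3, sin \<theta> * v$2 + cos \<theta> * v$3]"
  by (simp add: rot_C_def matrix_vector_mult_def vec_eq_iff forall_3 sum_3)

lemma rot_C_add: "rot_C \<theta> ** rot_C \<eta> = rot_C (\<theta> + \<eta>)"
  by (simp add: rot_C_def matrix_matrix_mult_def vec_eq_iff forall_3 sum_3 cos_add sin_add algebra_simps)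

lemma rot_C_eq_1: "cos \<theta> = 1 \<Longrightarrow> rot_C \<theta> = mat 1"
  using sin_cos_squared_add[of \<theta>] by (simp add: rot_C_def mat_def vec_eq_iff forall_3)

lemma matpow_rot_C: "matpow (rot_C \<theta>) n = rot_C (real n * \<theta>)"
  by (induction n) (simp_all add: rot_C_eq_1 rot_C_add algebra_simps)

lemma matpow_orthogonal_conj:
  assumes "orthogonal_matrix V"
  shows "matpow (V ** M ** transpose V) n = V ** matpow M n ** transpose V"
proof (induction n)
  case 0 show ?case using assms by (simp add: orthogonal_matrix_def)
next
  case (Suc n)
  have "matpow (V ** M ** transpose V) (Suc n)
      = V ** M ** (transpose V ** V) ** matpow M n ** transpose V"
    by (simp add: Suc matrix_mul_assoc)
  also have "transpose V ** V = mat 1" using assms by (simp add: orthogonal_matrix_def)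
  finally show ?case by (simp add: matrix_mul_assoc)
qed

lemma rational_rotation_finite_order:
  assumes "orthogonal_matrix V" "q \<in> \<rat>"
  obtains N where "N > 0" "matpow (V ** rot_C (q * pi) ** transpose V) N = mat 1"
proof -
  obtain a b :: int where ab: "b > 0" "q = of_int a / of_int b"
    using assms(2) by (meson Rats_cases')
  have eq: "real (2 * nat b) * (q * pi) = 0 + of_int a * (2 * pi)"
    using ab by (simp add: field_simps)
  have "cos (real (2 * nat b) * (q * pi)) = 1"
    unfolding eq using cos.plus_of_int[of "0::real" a] by simp
  then have "matpow (V ** rot_C (q * pi) ** transpose V) (2 * nat b) = mat 1"
    unfolding matpow_orthogonal_conj[OF assms(1)] matpow_rot_C
    using assms(1) by (simp add: rot_C_eq_1 orthogonal_matrix_def)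
  then show ?thesis using ab(1) by (intro that[of "2 * nat b"]) auto
qed

lemma rotation_plane_no_eigenvector:
  fixes c s r x y :: real
  assumes "c * x - s * y = r * x" "s * x + c * y = r * y" "s \<noteq> 0"
  shows "x = 0 \<and> y = 0"
proof -
  have "s * (x\<^sup>2 + y\<^sup>2) = (s * x + c * y) * x - (c * x - s * y) * y"
    by (simp add: power2_eq_square algebra_simps)
  also have "\<dots> = 0" unfolding assms(1,2) by simp
  finally show ?thesis using assms(3) by (simp add: add_nonneg_eq_0_iff)
qed

text \<open>A power of the rotation by \<open>\<psi> * pi\<close> with positive exponent is not the identity, because \<open>\<psi>\<close> is
irrational, so it fixes only the axis.\<close>

lemma irrational_rotation_fixed_vectors:
  assumes V: "orthogonal_matrix V" and "\<psi> \<notin> \<rat>" "m > 0"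
    and inv: "matpow (V ** rot_C (\<psi> * pi) ** transpose V) m *v v = v"
  shows "\<exists>r. v = r *\<^sub>R (V *v axis 1 1)"
proof -
  define \<theta> where "\<theta> = real m * (\<psi> * pi)"
  have "sin \<theta> \<noteq> 0"
  proof
    assume "sin \<theta> = 0"
    then obtain i :: int where "\<theta> = of_int i * pi" by (auto simp: sin_zero_iff_int2)
    then have "\<psi> = of_int i / of_nat m" using \<open>m > 0\<close> by (simp add: \<theta>_def field_simps)
    then show False using \<open>\<psi> \<notin> \<rat>\<close> by simp
  qed
  define w where "w = transpose V *v v"
  have v: "v = V *v w"
    using V by (simp add: w_def matrix_vector_mul_assoc orthogonal_matrix_def del: transpose_matrix_vector)
  have "rot_C \<theta> *v w = transpose V *v (matpow (V ** rot_C (\<psi> * pi) ** transpose V) m *v v)"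
    unfolding matpow_orthogonal_conj[OF V] matpow_rot_C \<theta>_def[symmetric] w_def
    using V by (simp add: matrix_vector_mul_assoc matrix_mul_assoc orthogonal_matrix_def del: transpose_matrix_vector)
  also have "\<dots> = w" by (simp add: inv w_def)
  finally have "cos \<theta> * w$2 - sin \<theta> * w$3 = 1 * w$2" "sin \<theta> * w$2 + cos \<theta> * w$3 = 1 * w$3"
    by (simp_all add: rot_C_mult_vec vec_eq_iff forall_3)
  then have "w$2 = 0 \<and> w$3 = 0"
    by (rule rotation_plane_no_eigenvector) fact
  then have "w = w$1 *\<^sub>R axis 1 1"
    by (simp add: vec_eq_iff forall_3 axis_def)
  then show ?thesis
    unfolding v by (metis matrix_vector_mult_scaleR)
qed

lemma rot_C_eigenvector:
  assumes "rot_C (q * pi) *v g = r *\<^sub>R g" "q \<notin> \<int>"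
  shows "g$2 = 0 \<and> g$3 = 0"
proof (rule rotation_plane_no_eigenvector)
  show "cos (q * pi) * g$2 - sin (q * pi) * g$3 = r * g$2"
    "sin (q * pi) * g$2 + cos (q * pi) * g$3 = r * g$3"
    using assms(1) by (simp_all add: rot_C_mult_vec vec_eq_iff forall_3)
  show "sin (q * pi) \<noteq> 0"
    using assms(2) by (auto simp: sin_zero_iff_int2)
qed

text \<open>The first column and the first row of \<open>V\<close> have norm 1. If one of them were a multiple of the first unit
vector, then \<open>V$1$1\<close>, which is the cosine of the angle, would be \<open>1\<close> or \<open>-1\<close>.\<close>

lemma axes_not_parallel:
  fixes V :: "real^3^3"
  assumes "rotation_matrix V" "vec_angle (vector [1, 0, 0]) (column 1 V) \<in> {0<..pi / 2}"
  shows "\<not> (V$2$1 = 0 \<and> V$3$1 = 0)" "\<not> (V$1$2 = 0 \<and> V$1$3 = 0)"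
proof -
  have "transpose V ** V = mat 1" "V ** transpose V = mat 1"
    using assms(1) by (auto simp: rotation_matrix_def orthogonal_matrix_def)
  from this[THEN arg_cong, of "\<lambda>M. M$1$1"]
  have col: "(V$1$1)\<^sup>2 + (V$2$1)\<^sup>2 + (V$3$1)\<^sup>2 = 1" and row: "(V$1$1)\<^sup>2 + (V$1$2)\<^sup>2 + (V$1$3)\<^sup>2 = 1"
    by (simp_all add: matrix_matrix_mult_def transpose_def sum_3 mat_def power2_eq_square)
  have "norm (vector [1, 0, 0] :: real^3) = 1"
    by (simp add: norm_eq_sqrt_inner inner_vec_def sum_3)
  moreover have "norm (column 1 V) = 1"
    using col by (simp add: norm_eq_sqrt_inner inner_vec_def sum_3 column_def power2_eq_square)
  ultimately have "vec_angle (vector [1, 0, 0]) (column 1 V) = arccos (V$1$1)"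
    by (simp add: vec_angle_def inner_vec_def sum_3 column_def)
  with assms(2) have "arccos (V$1$1) \<noteq> 0" "arccos (V$1$1) \<noteq> pi"
    by auto
  then have "V$1$1 \<noteq> 1" "V$1$1 \<noteq> -1" by auto
  then have "(V$1$1)\<^sup>2 \<noteq> 1" by (simp add: power2_eq_1_iff)
  with col row show "\<not> (V$2$1 = 0 \<and> V$3$1 = 0)" "\<not> (V$1$2 = 0 \<and> V$1$3 = 0)"
    by auto
qed

text \<open>The previous results apply to \<open>(A, B)\<close> for the quaternions of sign \<open>-1\<close> and to \<open>(B, A)\<close> for those of
sign \<open>1\<close>. In each case the rotation which moves the axis has an angle \<open>q * pi\<close> with \<open>q\<close> not an integer;
hence it has no eigenvectors besides its axis.\<close>

lemma closed_group_contains_rotations: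
  fixes Pp Pm :: "real^3 \<Rightarrow> real^3"
  assumes K: "closed K" "mat 1 \<in> K" and mult: "\<And>X Y. X \<in> K \<Longrightarrow> Y \<in> K \<Longrightarrow> X ** Y \<in> K"
    and A: "A \<in> K" "transpose A \<in> K" "orthogonal_matrix A"
    and B: "B \<in> K" "transpose B \<in> K" "orthogonal_matrix B"
    and Pp: "linear Pp" "inj Pp"
      "\<And>v. A ** kap 1 (Pp v) ** transpose A = kap 1 (Pp (rot_C (q\<^sub>1 * pi) *v v))"
      "\<And>v. B ** kap 1 (Pp v) ** transpose B = kap 1 (Pp ((V ** rot_C (\<psi>\<^sub>2 * pi) ** transpose V) *v v))"
    and Pm: "linear Pm" "inj Pm"
      "\<And>v. A ** kap (-1) (Pm v) ** transpose A = kap (-1) (Pm (rot_C (\<psi>\<^sub>1 * pi) *v v))"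
      "\<And>v. B ** kap (-1) (Pm v) ** transpose B = kap (-1) (Pm ((W ** rot_C (q\<^sub>2 * pi) ** transpose W) *v v))"
    and V: "rotation_matrix V" "vec_angle (vector [1, 0, 0]) (column 1 V) \<in> {0<..pi / 2}"
    and W: "rotation_matrix W" "vec_angle (vector [1, 0, 0]) (column 1 W) \<in> {0<..pi / 2}"
    and q: "q\<^sub>1 \<in> \<rat> - \<int>" "q\<^sub>2 \<in> \<rat> - \<int>" and \<psi>: "\<psi>\<^sub>1 \<notin> \<rat>" "\<psi>\<^sub>2 \<notin> \<rat>"
    and Y: "rotation_matrix Y"
  shows "Y \<in> K"
proof -
  have oV: "orthogonal_matrix V" "orthogonal_matrix W"
    using V W by (auto simp: rotation_matrix_def)
  have surj: "surj Pp" "surj Pm"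
    using linear_injective_imp_surjective[OF Pp(1,2)] linear_injective_imp_surjective[OF Pm(1,2)] by auto
  obtain N\<^sub>1 where N1: "N\<^sub>1 > 0" "matpow (rot_C (q\<^sub>1 * pi)) N\<^sub>1 = mat 1"
    using rational_rotation_finite_order[OF orthogonal_matrix_id, of q\<^sub>1] q by auto
  obtain N\<^sub>2 where N2: "N\<^sub>2 > 0" "matpow (W ** rot_C (q\<^sub>2 * pi) ** transpose W) N\<^sub>2 = mat 1"
    using rational_rotation_finite_order[OF oV(2), of q\<^sub>2] q by auto
  have "unit_quats (-1) \<subseteq> K"
  proof (rule unit_quats_in_closed_group[where P = Pp and Q = Pm and A = A and B = B and f = "axis 1 1"])
    show "\<exists>r. v = r *\<^sub>R axis 1 1" if "m > 0" "matpow (rot_C (\<psi>\<^sub>1 * pi)) m *v v = v" for m v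
      using irrational_rotation_fixed_vectors[OF orthogonal_matrix_id \<psi>(1) that(1), of v] that(2) by simp
    show "(W ** rot_C (q\<^sub>2 * pi) ** transpose W) *v axis 1 1 \<noteq> r *\<^sub>R axis 1 1" for r
    proof
      assume eq: "(W ** rot_C (q\<^sub>2 * pi) ** transpose W) *v axis 1 1 = r *\<^sub>R axis 1 1"
      define g where "g = transpose W *v axis 1 1"
      have "rot_C (q\<^sub>2 * pi) *v g = transpose W *v ((W ** rot_C (q\<^sub>2 * pi) ** transpose W) *v axis 1 1)"
        using oV by (simp add: g_def matrix_vector_mul_assoc matrix_mul_assoc orthogonal_matrix_def
            del: transpose_matrix_vector)
      also have "\<dots> = r *\<^sub>R g" by (simp only: eq g_def matrix_vector_mult_scaleR)
      finally have "g$2 = 0 \<and> g$3 = 0"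
        using q by (intro rot_C_eigenvector) auto
      then show False
        using axes_not_parallel(2)[OF W]
        by (simp add: g_def matrix_vector_mult_def transpose_def sum_3 axis_def)
    qed
  qed (use K mult A B Pp Pm surj N1 in auto)
  moreover have "unit_quats 1 \<subseteq> K"
  proof (rule unit_quats_in_closed_group[where P = Pm and Q = Pp and A = B and B = A and f = "V *v axis 1 1"])
    show "\<exists>r. v = r *\<^sub>R (V *v axis 1 1)" if "m > 0" "matpow (V ** rot_C (\<psi>\<^sub>2 * pi) ** transpose V) m *v v = v" for m v
      using irrational_rotation_fixed_vectors[OF oV(1) \<psi>(2) that] .
    show "rot_C (q\<^sub>1 * pi) *v (V *v axis 1 1) \<noteq> r *\<^sub>R (V *v axis 1 1)" for r
    proof
      assume "rot_C (q\<^sub>1 * pi) *v (V *v axis 1 1) = r *\<^sub>R (V *v axis 1 1)"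
      then have "(V *v axis 1 1)$2 = 0 \<and> (V *v axis 1 1)$3 = 0"
        using q by (intro rot_C_eigenvector) auto
      then show False
        using axes_not_parallel(1)[OF V] by (simp add: matrix_vector_mult_def sum_3 axis_def)
    qed
  qed (use K mult A B Pp Pm surj N2 in auto)
  moreover obtain X Z where "X \<in> unit_quats 1" "Z \<in> unit_quats (-1)" "Y = X ** Z"
    using rotation_matrix_factor[of 1, OF _ Y] by auto
  ultimately show ?thesis using mult by auto
qed

section \<open>Smooth functions on the torus\<close>

lemma frechet_derivative_cong_open:
  assumes "open S" "x \<in> S" "\<And>y. y \<in> S \<Longrightarrow> f y = g y"
  shows "frechet_derivative f (at x) = frechet_derivative g (at x)"
proof -
  have "(f has_derivative D) (at x) \<longleftrightarrow> (g has_derivative D) (at x)" for D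
    using assms by (auto intro: has_derivative_transform_within_open[OF _ assms(1,2)])
  then show ?thesis by (simp add: frechet_derivative_def)
qed

lemma Ck_on_cong:
  assumes "open S" "\<And>y. y \<in> S \<Longrightarrow> f y = g y"
  shows "Ck_on k S f \<longleftrightarrow> Ck_on k S g"
  using assms(2)
proof (induction k arbitrary: f g)
  case 0
  then show ?case using continuous_on_cong[of S S f g] by simp
next
  case (Suc k)
  have "f differentiable_on S \<longleftrightarrow> g differentiable_on S"
    using Suc.prems unfolding differentiable_on_def differentiable_def
    by (metis has_derivative_transform)
  moreover have "Ck_on k S (\<lambda>x. frechet_derivative f (at x) v) \<longleftrightarrow>
      Ck_on k S (\<lambda>x. frechet_derivative g (at x) v)" for v
    using frechet_derivative_cong_open[OF assms(1) _ Suc.prems] by (intro Suc.IH) simp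
  ultimately show ?case by simp
qed

lemma Ck_on_const: "Ck_on k S (\<lambda>_. c)"
  by (induction k arbitrary: c) (auto simp: frechet_derivative_const)

lemma Ck_on_Suc_imp: "Ck_on (Suc k) S f \<Longrightarrow> Ck_on k S f"
  by (induction k arbitrary: f) (auto intro: differentiable_imp_continuous_on)

lemma Ck_on_subset: "Ck_on k S f \<Longrightarrow> T \<subseteq> S \<Longrightarrow> Ck_on k T f"
  by (induction k arbitrary: f) (auto intro: continuous_on_subset differentiable_on_subset)

text \<open>The derivative may be given by any formula valid on \<open>S\<close>, as \<open>S\<close> is open.\<close>

lemma Ck_on_SucI:
  assumes "open S" "\<And>x. x \<in> S \<Longrightarrow> (f has_derivative f' x) (at x)" "\<And>v. Ck_on k S (\<lambda>x. f' x v)"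
  shows "Ck_on (Suc k) S f"
proof -
  have "frechet_derivative f (at x) = f' x" if "x \<in> S" for x
    using frechet_derivative_at[OF assms(2)[OF that]] by simp
  then have "Ck_on k S (\<lambda>x. frechet_derivative f (at x) v)" for v
    using assms(3)[of v] Ck_on_cong[OF assms(1), of "\<lambda>x. f' x v" "\<lambda>x. frechet_derivative f (at x) v" k] by simp
  moreover have "f differentiable_on S"
    using assms(2) by (auto simp: differentiable_on_def differentiable_def intro: has_derivative_at_withinI)
  ultimately show ?thesis by simp
qed

lemma Ck_on_SucD:
  assumes "open S" "Ck_on (Suc k) S f" "x \<in> S"
  shows "(f has_derivative frechet_derivative f (at x)) (at x)"
  using assms by (simp add: differentiable_on_eq_differentiable_at frechet_derivative_works)

lemma Ck_on_bounded_linear: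
  assumes "bounded_linear L" "open S" "Ck_on k S f"
  shows "Ck_on k S (\<lambda>x. L (f x))"
  using assms(3)
proof (induction k arbitrary: f)
  case 0
  then show ?case using bounded_linear.continuous_on[OF assms(1)] by simp
next
  case (Suc k)
  show ?case
  proof (rule Ck_on_SucI[OF assms(2)])
    show "((\<lambda>x. L (f x)) has_derivative (\<lambda>v. L (frechet_derivative f (at x) v))) (at x)" if "x \<in> S" for x
      using bounded_linear.has_derivative[OF assms(1) Ck_on_SucD[OF assms(2) Suc.prems that]] .
    show "Ck_on k S (\<lambda>x. L (frechet_derivative f (at x) v))" for v
      using Suc by simp
  qed
qed

lemma Ck_on_add:
  assumes "open S" "Ck_on k S f" "Ck_on k S g"
  shows "Ck_on k S (\<lambda>x. f x + g x)"
  using assms(2,3)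
proof (induction k arbitrary: f g)
  case 0
  then show ?case by (auto intro: continuous_on_add)
next
  case (Suc k)
  show ?case
  proof (rule Ck_on_SucI[OF assms(1)])
    show "((\<lambda>x. f x + g x) has_derivative
        (\<lambda>v. frechet_derivative f (at x) v + frechet_derivative g (at x) v)) (at x)" if "x \<in> S" for x
      by (intro has_derivative_add Ck_on_SucD[OF assms(1) Suc.prems(1) that]
          Ck_on_SucD[OF assms(1) Suc.prems(2) that])
    show "Ck_on k S (\<lambda>x. frechet_derivative f (at x) v + frechet_derivative g (at x) v)" for v
      using Suc by simp
  qed
qed

lemma Ck_on_bounded_bilinear:
  assumes "bounded_bilinear B" "open S" "Ck_on k S f" "Ck_on k S g"
  shows "Ck_on k S (\<lambda>x. B (f x) (g x))"
  using assms(3,4)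
proof (induction k arbitrary: f g)
  case 0
  then show ?case using bounded_bilinear.continuous_on[OF assms(1)] by simp
next
  case (Suc k)
  show ?case
  proof (rule Ck_on_SucI[OF assms(2)])
    show "((\<lambda>x. B (f x) (g x)) has_derivative
        (\<lambda>v. B (f x) (frechet_derivative g (at x) v) + B (frechet_derivative f (at x) v) (g x))) (at x)"
      if "x \<in> S" for x
      by (intro bounded_bilinear.FDERIV[OF assms(1)] Ck_on_SucD[OF assms(2) Suc.prems(1) that]
          Ck_on_SucD[OF assms(2) Suc.prems(2) that])
    show "Ck_on k S (\<lambda>x. B (f x) (frechet_derivative g (at x) v) + B (frechet_derivative f (at x) v) (g x))" for v
      using Suc.prems Ck_on_Suc_imp[OF Suc.prems(1)] Ck_on_Suc_imp[OF Suc.prems(2)]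
      by (intro Ck_on_add[OF assms(2)] Suc.IH) auto
  qed
qed

lemma torus_open_Int: "torus_open U \<Longrightarrow> torus_open W \<Longrightarrow> torus_open (U \<inter> W)"
  by (simp add: torus_open_def vimage_Int open_Int)

context
  fixes U :: "torus set"
  assumes U: "torus_open U"
begin

lemma torus_smooth_cong:
  "(\<And>p. p \<in> U \<Longrightarrow> f p = g p) \<Longrightarrow> torus_smooth_on U f \<Longrightarrow> torus_smooth_on U g"
  using Ck_on_cong[of "pr -` U" "\<lambda>z. f (pr z)" "\<lambda>z. g (pr z)"] U
  by (simp add: torus_smooth_on_def smooth_on_def torus_open_def)

lemma torus_smooth_const: "torus_smooth_on U (\<lambda>_. c)"
  by (simp add: torus_smooth_on_def smooth_on_def Ck_on_const)

lemma torus_smooth_add: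
  "torus_smooth_on U f \<Longrightarrow> torus_smooth_on U g \<Longrightarrow> torus_smooth_on U (\<lambda>p. f p + g p)"
  using U by (simp add: torus_smooth_on_def smooth_on_def torus_open_def Ck_on_add)

lemma torus_smooth_bounded_linear:
  "bounded_linear L \<Longrightarrow> torus_smooth_on U f \<Longrightarrow> torus_smooth_on U (\<lambda>p. L (f p))"
  using U by (simp add: torus_smooth_on_def smooth_on_def torus_open_def Ck_on_bounded_linear[of L])

lemma torus_smooth_bounded_bilinear:
  "bounded_bilinear B \<Longrightarrow> torus_smooth_on U f \<Longrightarrow> torus_smooth_on U g \<Longrightarrow> torus_smooth_on U (\<lambda>p. B (f p) (g p))"
  using U by (simp add: torus_smooth_on_def smooth_on_def torus_open_def Ck_on_bounded_bilinear[of B])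

lemmas torus_smooth_scaleR = torus_smooth_bounded_bilinear[OF bounded_bilinear_scaleR]
lemmas torus_smooth_mult = torus_smooth_bounded_bilinear[OF bounded_bilinear_mult]
lemmas torus_smooth_nth = torus_smooth_bounded_linear[OF bounded_linear_vec_nth]

lemma torus_smooth_diff:
  fixes f g :: "torus \<Rightarrow> 'b::real_normed_vector"
  shows "torus_smooth_on U f \<Longrightarrow> torus_smooth_on U g \<Longrightarrow> torus_smooth_on U (\<lambda>p. f p - g p)"
  using torus_smooth_add[of f "\<lambda>p. - g p"]
    torus_smooth_bounded_linear[OF bounded_linear_minus[OF bounded_linear_ident], of g] by simp

lemma torus_smooth_sum:
  "(\<And>i. i \<in> I \<Longrightarrow> torus_smooth_on U (f i)) \<Longrightarrow> torus_smooth_on U (\<lambda>p. \<Sum>i\<in>I. f i p)"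
  by (induction I rule: infinite_finite_induct) (simp_all add: torus_smooth_const torus_smooth_add)

lemma torus_smooth_vec:
  fixes f :: "torus \<Rightarrow> real^'n"
  assumes "\<And>i. torus_smooth_on U (\<lambda>p. f p $ i)"
  shows "torus_smooth_on U f"
proof (rule torus_smooth_cong)
  show "torus_smooth_on U (\<lambda>p. \<Sum>i\<in>UNIV. (f p $ i) *\<^sub>R axis i 1)"
    by (intro torus_smooth_sum torus_smooth_scaleR assms torus_smooth_const)
  show "(\<Sum>i\<in>UNIV. (f p $ i) *\<^sub>R axis i 1) = f p" for p
    using basis_expansion[of "f p"] by (simp add: scalar_mult_eq_scaleR)
qed

lemma torus_smooth_differentiable:
  assumes "torus_smooth_on U f" "pr z \<in> U"
  shows "((\<lambda>z. f (pr z)) has_derivative frechet_derivative (\<lambda>z. f (pr z)) (at z)) (at z)"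
proof -
  have "Ck_on (Suc 0) (pr -` U) (\<lambda>z. f (pr z))"
    using assms(1) unfolding torus_smooth_on_def smooth_on_def by blast
  then show ?thesis
    using assms(2) U by (intro Ck_on_SucD[of "pr -` U" 0]) (auto simp: torus_open_def)
qed

lemma torus_smooth_along_line:
  fixes f :: "torus \<Rightarrow> real"
  assumes "torus_smooth_on U f" "pr (t *\<^sub>R w) \<in> U"
  shows "((\<lambda>s. f (pr (s *\<^sub>R w))) has_real_derivative
     frechet_derivative (\<lambda>z. f (pr z)) (at (t *\<^sub>R w)) w) (at t)"
proof -
  let ?D = "frechet_derivative (\<lambda>z. f (pr z)) (at (t *\<^sub>R w))"
  have D: "((\<lambda>z. f (pr z)) has_derivative ?D) (at (t *\<^sub>R w))"
    by (rule torus_smooth_differentiable[OF assms])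
  have "((\<lambda>s. s *\<^sub>R w) has_derivative (\<lambda>s. s *\<^sub>R w)) (at t)"
    by (auto intro!: derivative_eq_intros)
  from diff_chain_at[OF this D]
  have "((\<lambda>s. f (pr (s *\<^sub>R w))) has_derivative (\<lambda>s. ?D (s *\<^sub>R w))) (at t)"
    by (simp add: o_def)
  moreover have "?D (s *\<^sub>R w) = ?D w * s" for s
    using linear_cmul[OF has_derivative_linear[OF D]] by simp
  ultimately show ?thesis
    by (simp add: has_field_derivative_def)
qed

text \<open>Local formulas in a chart around \<open>pr (t *\<^sub>R w)\<close> are valid for all nearby parameters.\<close>

lemma line_stays_in:
  assumes "pr (t *\<^sub>R w) \<in> U"
  shows "\<forall>\<^sub>F s in nhds t. pr (s *\<^sub>R w) \<in> U"
proof -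
  have "open ((\<lambda>s. s *\<^sub>R w) -` (pr -` U))"
    using U by (intro open_vimage) (auto simp: torus_open_def intro!: continuous_intros)
  from eventually_nhds_in_open[OF this, of t] show ?thesis
    using assms by simp
qed

end

lemma torus_smooth_subset: "torus_smooth_on U f \<Longrightarrow> W \<subseteq> U \<Longrightarrow> torus_smooth_on W f"
  unfolding torus_smooth_on_def smooth_on_def by (meson Ck_on_subset vimage_mono)

section \<open>Parallel sections and the bundle metric\<close>

lemma fibre_subspace:
  assumes "oriented_vector_bundle E"
  shows "subspace (fibre E p)"
proof -
  obtain U e where "(U, e) \<in> atlas E" "p \<in> U"
    using assms unfolding oriented_vector_bundle_def by blast
  then have "is_basis (fibre E p) (e p)"
    using assms unfolding oriented_vector_bundle_def by blast
  then show ?thesis unfolding is_basis_def by (metis subspace_span)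
qed

lemma frame_in_fibre:
  assumes "oriented_vector_bundle E" "(U, e) \<in> atlas E" "p \<in> U"
  shows "e p $ i \<in> fibre E p"
proof -
  have "is_basis (fibre E p) (e p)"
    using assms unfolding oriented_vector_bundle_def by blast
  then show ?thesis unfolding is_basis_def by (metis rangeI span_base)
qed

lemma atlas_open:
  assumes "oriented_vector_bundle E" "(U, e) \<in> atlas E"
  shows "torus_open U"
  using assms unfolding oriented_vector_bundle_def by blast

lemma bundle_metric_scaleR_sum:
  assumes "bundle_metric E h" "subspace (fibre E p)" "v \<in> fibre E p"
    and "\<And>i. i \<in> I \<Longrightarrow> u i \<in> fibre E p"
  shows "h p (\<Sum>i\<in>I. a i *\<^sub>R u i) v = (\<Sum>i\<in>I. a i * h p (u i) v)"
    and "h p v (\<Sum>i\<in>I. a i *\<^sub>R u i) = (\<Sum>i\<in>I. a i * h p v (u i))"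
proof -
  note h = assms(1)[unfolded bundle_metric_def, THEN conjunct1, rule_format, of _ p]
  have z: "h p 0 v = 0"
    using h[of 0 v] assms(3) subspace_0[OF assms(2)] by (metis mult_zero_left scaleR_zero_left)
  show 1: "h p (\<Sum>i\<in>I. a i *\<^sub>R u i) v = (\<Sum>i\<in>I. a i * h p (u i) v)"
    using assms(4)
  proof (induction I rule: infinite_finite_induct)
    case (insert i I)
    have *: "(\<Sum>i\<in>I. a i *\<^sub>R u i) \<in> fibre E p" "a i *\<^sub>R u i \<in> fibre E p" "u i \<in> fibre E p"
      using insert.prems by (auto intro!: subspace_sum subspace_scale assms(2))
    have "h p (a i *\<^sub>R u i + (\<Sum>i\<in>I. a i *\<^sub>R u i)) v = h p (a i *\<^sub>R u i) v + h p (\<Sum>i\<in>I. a i *\<^sub>R u i) v"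
      using h[OF *(2,1)] assms(3) by blast
    also have "h p (a i *\<^sub>R u i) v = a i * h p (u i) v"
      using h[OF *(3) assms(3)] by blast
    finally show ?case using insert by simp
  qed (simp_all add: z)
  have "(\<Sum>i\<in>I. a i *\<^sub>R u i) \<in> fibre E p"
    using assms(4) by (auto intro!: subspace_sum subspace_scale assms(2))
  then have "h p v (\<Sum>i\<in>I. a i *\<^sub>R u i) = h p (\<Sum>i\<in>I. a i *\<^sub>R u i) v"
    using h assms(3) by blast
  also have "\<dots> = (\<Sum>i\<in>I. a i * h p v (u i))"
    unfolding 1 using h assms(3,4) by (intro sum.cong refl) metis
  finally show "h p v (\<Sum>i\<in>I. a i *\<^sub>R u i) = (\<Sum>i\<in>I. a i * h p v (u i))" .
qed

lemma bundle_metric_add: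
  assumes "bundle_metric E h" "u \<in> fibre E p" "v \<in> fibre E p" "w \<in> fibre E p"
  shows "h p (u + v) w = h p u w + h p v w"
  using assms(1)[unfolded bundle_metric_def, THEN conjunct1, rule_format, of u p v] assms(2-4) by blast

lemma bundle_metric_zero:
  assumes "bundle_metric E h" "subspace (fibre E p)" "v \<in> fibre E p"
  shows "h p 0 v = 0"
  using bundle_metric_scaleR_sum(1)[OF assms, of "{}"] by simp

lemma bundle_metric_sym:
  assumes "bundle_metric E h" "u \<in> fibre E p" "v \<in> fibre E p"
  shows "h p u v = h p v u"
  using assms(1)[unfolded bundle_metric_def, THEN conjunct1, rule_format, of u p v] assms(2-3) by blast

lemma smooth_section_subset:
  assumes "smooth_section E U s" "W \<subseteq> U"
  shows "smooth_section E W s"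
  unfolding smooth_section_def
proof (intro conjI ballI, goal_cases)
  case (1 p)
  then show ?case using assms by (auto simp: smooth_section_def)
next
  case (2 x)
  obtain W' e where x: "x = (W', e)" by force
  then obtain c :: "torus \<Rightarrow> real^'b" where "torus_smooth_on (U \<inter> W') c"
    "\<forall>p\<in>U \<inter> W'. s p = (\<Sum>i\<in>UNIV. (c p $ i) *\<^sub>R (e p $ i))"
    using 2 assms(1) unfolding smooth_section_def by blast
  moreover have "W \<inter> W' \<subseteq> U \<inter> W'" using assms(2) by blast
  ultimately show ?case unfolding x using torus_smooth_subset by blast
qed

lemma atlas_transition:
  assumes "oriented_vector_bundle E" "(U, e) \<in> atlas E" "(W, f) \<in> atlas E"
  obtains g :: "torus \<Rightarrow> real^'n::finite^'n" where "torus_smooth_on (U \<inter> W) g"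
    "\<And>p. p \<in> U \<inter> W \<Longrightarrow> f p = row_mult (e p) (g p)" "\<And>p. p \<in> U \<inter> W \<Longrightarrow> det (g p) > 0"
proof -
  have "\<forall>(U, e)\<in>atlas E. \<forall>(W, f)\<in>atlas E. \<exists>g :: torus \<Rightarrow> real^'n^'n. torus_smooth_on (U \<inter> W) g \<and>
          (\<forall>p\<in>U \<inter> W. f p = row_mult (e p) (g p) \<and> det (g p) > 0)"
    using assms(1) unfolding oriented_vector_bundle_def by (elim conjE)
  from this[rule_format, OF assms(2), simplified, rule_format, OF assms(3)] show ?thesis
    using that by auto
qed

lemma frame_smooth_section:
  assumes E: "oriented_vector_bundle E" and Ue: "(U, e) \<in> atlas E"
  shows "smooth_section E U (\<lambda>p. e p $ i)"
  unfolding smooth_section_def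
proof (intro conjI ballI, goal_cases)
  case (1 p)
  then show ?case using frame_in_fibre[OF E Ue] by simp
next
  case (2 x)
  obtain W f where x: "x = (W, f)" by force
  then obtain g :: "torus \<Rightarrow> real^'b^'b" where g: "torus_smooth_on (W \<inter> U) g"
      "\<And>p. p \<in> W \<inter> U \<Longrightarrow> e p = row_mult (f p) (g p)"
    using atlas_transition[OF E _ Ue, of W f] 2 unfolding x by metis
  have op: "torus_open (U \<inter> W)"
    using atlas_open[OF E] Ue 2 x by (auto intro: torus_open_Int)
  have "torus_smooth_on (U \<inter> W) (\<lambda>p. \<chi> j. g p $ j $ i)"
    using g(1) by (intro torus_smooth_vec op) (auto simp: Int_commute intro!: torus_smooth_nth op)
  moreover have "e p $ i = (\<Sum>j\<in>UNIV. ((\<chi> j. g p $ j $ i) $ j) *\<^sub>R (f p $ j))" if "p \<in> U \<inter> W" for p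
    using g(2)[of p] that by (simp add: row_mult_def)
  ultimately show ?case unfolding x by blast
qed

text \<open>The metric is only given to be smooth on pairs of vectors of the same frame, so \<open>s\<close> is expanded in
the frame \<open>f\<close>.\<close>

lemma metric_pairing_smooth:
  assumes E: "oriented_vector_bundle E" and h: "bundle_metric E h"
    and Wf: "(W, f) \<in> atlas E" and U: "torus_open U" and s: "smooth_section E U s"
  shows "torus_smooth_on (U \<inter> W) (\<lambda>p. h p (f p $ i) (s p))"
proof -
  obtain c :: "torus \<Rightarrow> real^'b" where c: "torus_smooth_on (U \<inter> W) c"
    "\<And>p. p \<in> U \<inter> W \<Longrightarrow> s p = (\<Sum>k\<in>UNIV. (c p $ k) *\<^sub>R (f p $ k))"
    using s Wf unfolding smooth_section_def by blast
  have op: "torus_open (U \<inter> W)"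
    using atlas_open[OF E Wf] U by (rule torus_open_Int[rotated])
  have hs: "torus_smooth_on (U \<inter> W) (\<lambda>p. h p (f p $ i) (f p $ k))" for k
    using h Wf unfolding bundle_metric_def by (blast intro: torus_smooth_subset)
  show ?thesis
  proof (rule torus_smooth_cong[OF op])
    show "torus_smooth_on (U \<inter> W) (\<lambda>p. \<Sum>k\<in>UNIV. c p $ k * h p (f p $ i) (f p $ k))"
      by (intro torus_smooth_sum torus_smooth_mult torus_smooth_nth op c hs)
    show "(\<Sum>k\<in>UNIV. c p $ k * h p (f p $ i) (f p $ k)) = h p (f p $ i) (s p)" if "p \<in> U \<inter> W" for p
      unfolding c(2)[OF that] using frame_in_fibre[OF E Wf] that
      by (intro bundle_metric_scaleR_sum(2)[OF h fibre_subspace[OF E], symmetric]) auto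
  qed
qed

lemma connection_smooth:
  assumes "connection E D" "torus_open U" "smooth_section E U s"
  shows "smooth_section E U (D w s)"
  using assms unfolding connection_def by blast

text \<open>The Leibniz rule for the metric along a line, in which the term with the covariant derivative of \<open>\<xi>\<close>
vanishes. In the definition of a parallel section the coefficients of \<open>\<xi>\<close> live on the line only, while
\<open>D\<close> acts on sections over open sets. So the metric is differentiated on the frame vectors, and the
terms are collected.\<close>

lemma parallel_pairing_derivative:
  assumes E: "oriented_vector_bundle E" and h: "bundle_metric E h" and D: "metric_connection E h D"
    and \<xi>: "parallel_along E D w \<xi>" and U: "torus_open U" "pr (t *\<^sub>R w) \<in> U" and s: "smooth_section E U s"
  shows "((\<lambda>x. h (pr (x *\<^sub>R w)) (\<xi> x) (s (pr (x *\<^sub>R w)))) has_real_derivative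
      h (pr (t *\<^sub>R w)) (\<xi> t) (D w s (pr (t *\<^sub>R w)))) (at t)"
proof -
  let ?\<gamma> = "\<lambda>x. pr (x *\<^sub>R w)"
  let ?p = "?\<gamma> t"
  obtain W f c c' where Wf: "(W, f) \<in> atlas E" and pW: "?p \<in> W"
    and c: "\<And>x. ?\<gamma> x \<in> W \<Longrightarrow> \<xi> x = (\<Sum>i\<in>UNIV. (c x $ i) *\<^sub>R (f (?\<gamma> x) $ i))"
    and c': "(c has_vector_derivative c') (at t)"
    and par: "(\<Sum>i\<in>UNIV. (c' $ i) *\<^sub>R (f ?p $ i) + (c t $ i) *\<^sub>R D w (\<lambda>p. f p $ i) ?p) = 0"
    using \<xi> unfolding parallel_along_def by blast
  have op: "torus_open (U \<inter> W)"
    using atlas_open[OF E Wf] U(1) by (rule torus_open_Int[rotated])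
  have pUW: "?p \<in> U \<inter> W" using U pW by simp
  have conn: "connection E D" using D by (simp add: metric_connection_def)
  note sub = fibre_subspace[OF E]
  have fs: "smooth_section E W (\<lambda>p. f p $ i)" for i
    by (rule frame_smooth_section[OF E Wf])
  have ffib: "f p $ i \<in> fibre E p" if "p \<in> W" for p i
    using frame_in_fibre[OF E Wf that] .
  have sfib: "s p \<in> fibre E p" if "p \<in> U" for p
    using s that by (simp add: smooth_section_def)
  have Dsfib: "D w s ?p \<in> fibre E ?p"
    using connection_smooth[OF conn U(1) s] U(2) by (simp add: smooth_section_def)
  have Dffib: "D w (\<lambda>p. f p $ i) ?p \<in> fibre E ?p" for i
    using connection_smooth[OF conn atlas_open[OF E Wf] fs] pW by (simp add: smooth_section_def)
  let ?h = "h ?p"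
  have deriv: "((\<lambda>x. h (?\<gamma> x) (f (?\<gamma> x) $ i) (s (?\<gamma> x))) has_real_derivative
      ?h (D w (\<lambda>p. f p $ i) ?p) (s ?p) + ?h (f ?p $ i) (D w s ?p)) (at t)" for i
  proof -
    have "smooth_section E (U \<inter> W) s" "smooth_section E (U \<inter> W) (\<lambda>p. f p $ i)"
      using s fs by (auto intro: smooth_section_subset)
    then have "frechet_derivative (\<lambda>z. h (pr z) (f (pr z) $ i) (s (pr z))) (at (t *\<^sub>R w)) w =
        ?h (D w (\<lambda>p. f p $ i) ?p) (s ?p) + ?h (f ?p $ i) (D w s ?p)"
      using D op pUW unfolding metric_connection_def by blast
    then show ?thesis
      using torus_smooth_along_line[OF op metric_pairing_smooth[OF E h Wf U(1) s, of i] pUW] by simp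
  qed
  have ci: "((\<lambda>x. c x $ i) has_real_derivative c' $ i) (at t)" for i
    using bounded_linear.has_vector_derivative[OF bounded_linear_vec_nth c']
    by (simp add: has_real_derivative_iff_has_vector_derivative)
  have "((\<lambda>x. \<Sum>i\<in>UNIV. c x $ i * h (?\<gamma> x) (f (?\<gamma> x) $ i) (s (?\<gamma> x))) has_real_derivative
      (\<Sum>i\<in>UNIV. c' $ i * ?h (f ?p $ i) (s ?p)
        + (?h (D w (\<lambda>p. f p $ i) ?p) (s ?p) + ?h (f ?p $ i) (D w s ?p)) * c t $ i)) (at t)"
    by (intro DERIV_sum DERIV_mult ci deriv)
  also have "(\<Sum>i\<in>UNIV. c' $ i * ?h (f ?p $ i) (s ?p)
        + (?h (D w (\<lambda>p. f p $ i) ?p) (s ?p) + ?h (f ?p $ i) (D w s ?p)) * c t $ i)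
     = ?h (\<Sum>i\<in>UNIV. c' $ i *\<^sub>R f ?p $ i) (s ?p) + ?h (\<Sum>i\<in>UNIV. c t $ i *\<^sub>R D w (\<lambda>p. f p $ i) ?p) (s ?p)
       + ?h (\<Sum>i\<in>UNIV. c t $ i *\<^sub>R f ?p $ i) (D w s ?p)"
    by (subst (1 2 3) bundle_metric_scaleR_sum(1)[OF h sub])
       (auto simp: ffib[OF pW] Dffib sfib[OF U(2)] Dsfib sum.distrib algebra_simps)
  also have "?h (\<Sum>i\<in>UNIV. c' $ i *\<^sub>R f ?p $ i) (s ?p) + ?h (\<Sum>i\<in>UNIV. c t $ i *\<^sub>R D w (\<lambda>p. f p $ i) ?p) (s ?p)
      = ?h ((\<Sum>i\<in>UNIV. c' $ i *\<^sub>R f ?p $ i) + (\<Sum>i\<in>UNIV. c t $ i *\<^sub>R D w (\<lambda>p. f p $ i) ?p)) (s ?p)"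
    by (rule bundle_metric_add[OF h, symmetric])
       (auto intro!: subspace_sum subspace_scale sub simp: ffib[OF pW] Dffib sfib[OF U(2)])
  also have "(\<Sum>i\<in>UNIV. c' $ i *\<^sub>R f ?p $ i) + (\<Sum>i\<in>UNIV. c t $ i *\<^sub>R D w (\<lambda>p. f p $ i) ?p) = 0"
    using par by (simp add: sum.distrib)
  also have "?h 0 (s ?p) = 0"
    by (rule bundle_metric_zero[OF h sub sfib[OF U(2)]])
  also have "(\<Sum>i\<in>UNIV. c t $ i *\<^sub>R f ?p $ i) = \<xi> t"
    using c[OF pW] by simp
  finally have "((\<lambda>x. \<Sum>i\<in>UNIV. c x $ i * h (?\<gamma> x) (f (?\<gamma> x) $ i) (s (?\<gamma> x)))
      has_real_derivative ?h (\<xi> t) (D w s ?p)) (at t)" by simp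
  moreover have "\<forall>\<^sub>F x in nhds t. (\<Sum>i\<in>UNIV. c x $ i * h (?\<gamma> x) (f (?\<gamma> x) $ i) (s (?\<gamma> x)))
      = h (?\<gamma> x) (\<xi> x) (s (?\<gamma> x))"
    using line_stays_in[OF op pUW]
  proof eventually_elim
    case (elim x)
    then show ?case
      by (simp add: c) (subst bundle_metric_scaleR_sum(1)[OF h sub]; auto simp: ffib sfib)
  qed
  ultimately show ?thesis
    by (rule DERIV_cong_ev[OF refl _ refl, THEN iffD1, rotated])
qed

section \<open>Parallel bivectors\<close>

lemma exhaust_6: fixes x :: 6 shows "x = 1 \<or> x = 2 \<or> x = 3 \<or> x = 4 \<or> x = 5 \<or> x = 6"
proof (induct x)
  case (of_int z)
  then have "z = 0 \<or> z = 1 \<or> z = 2 \<or> z = 3 \<or> z = 4 \<or> z = 5" by simp linarith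
  then show ?case by auto
qed

lemma UNIV_6: "UNIV = {1, 2, 3, 4, 5, 6::6}"
  using exhaust_6 by auto

lemma sum_6: "sum f (UNIV::6 set) = f 1 + f 2 + f 3 + f 4 + f 5 + f 6"
  unfolding UNIV_6 by (simp add: ac_simps)

lemma vector_6:
  "(vector [a, b, c, d, e, f] :: 'a::zero^6) $ 1 = a" "(vector [a, b, c, d, e, f] :: 'a::zero^6) $ 2 = b"
  "(vector [a, b, c, d, e, f] :: 'a::zero^6) $ 3 = c" "(vector [a, b, c, d, e, f] :: 'a::zero^6) $ 4 = d"
  "(vector [a, b, c, d, e, f] :: 'a::zero^6) $ 5 = e" "(vector [a, b, c, d, e, f] :: 'a::zero^6) $ 6 = f"
  unfolding vector_def by simp_all

lemma dual_linear: "linear (dual_apply \<alpha>)"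
  using dual_apply by blast

lemma dual_apply_simps [simp]:
  "dual_apply \<alpha> (u + v) = dual_apply \<alpha> u + dual_apply \<alpha> v"
  "dual_apply \<alpha> (a *\<^sub>R v) = a * dual_apply \<alpha> v"
  using linear_add[OF dual_linear] linear_cmul[OF dual_linear] by auto

lemma wedge_apply: "(v \<and>\<^sub>v w) \<alpha> \<beta> = dual_apply \<alpha> v * dual_apply \<beta> w - dual_apply \<alpha> w * dual_apply \<beta> v"
  by (simp add: wedge_def)

lemma scaleR_bivector_apply [simp]: "(a *\<^sub>R (X :: 'v::real_vector bivector)) \<alpha> \<beta> = a * X \<alpha> \<beta>"
  by (simp add: scaleR_fun_def)

text \<open>The coefficients of a wedge product are the 2 by 2 minors of the coefficients of its factors.\<close>

lemma wedge_expand_4: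
  "(\<Sum>i\<in>UNIV. (a $ i) *\<^sub>R (e $ i)) \<and>\<^sub>v (\<Sum>i\<in>UNIV. (b $ i) *\<^sub>R (e $ i)) =
    (\<Sum>i\<in>UNIV. ((vector [a$1 * b$2 - a$2 * b$1, a$1 * b$3 - a$3 * b$1, a$1 * b$4 - a$4 * b$1,
       a$2 * b$3 - a$3 * b$2, a$2 * b$4 - a$4 * b$2, a$3 * b$4 - a$4 * b$3] :: real^6) $ i)
      *\<^sub>R (wedge_basis (e :: 'v::real_vector^4) $ i))"
  by (intro ext) (simp add: sum_4 sum_6 vector_6 wedge_basis_def wedge_apply algebra_simps)

lemma wedge_in_Ext2: "v \<in> fibre E p \<Longrightarrow> w \<in> fibre E p \<Longrightarrow> v \<and>\<^sub>v w \<in> fibre (Ext2 E) p"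
  by (auto simp: Ext2_def intro!: span_base)

lemma subspace_Ext2: "subspace (fibre (Ext2 E) p)"
  by (simp add: Ext2_def)

lemma smooth_section_wedge:
  fixes E :: "('v::real_vector, 4) vbundle"
  assumes E: "oriented_vector_bundle E" and U: "torus_open U"
    and s: "smooth_section E U s" and t: "smooth_section E U t"
  shows "smooth_section (Ext2 E) U (\<lambda>p. s p \<and>\<^sub>v t p)"
  unfolding smooth_section_def
proof (intro conjI ballI, goal_cases)
  case (1 p)
  then show ?case
    using s t unfolding smooth_section_def by (intro wedge_in_Ext2) blast+
next
  case (2 x)
  then obtain W f where x: "x = (W, \<lambda>p. wedge_basis (f p))" and Wf: "(W, f) \<in> atlas E"
    by (auto simp: Ext2_def)
  obtain a :: "torus \<Rightarrow> real^4" where a: "torus_smooth_on (U \<inter> W) a"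
    "\<And>p. p \<in> U \<inter> W \<Longrightarrow> s p = (\<Sum>i\<in>UNIV. (a p $ i) *\<^sub>R (f p $ i))"
    using s Wf unfolding smooth_section_def by blast
  obtain b :: "torus \<Rightarrow> real^4" where b: "torus_smooth_on (U \<inter> W) b"
    "\<And>p. p \<in> U \<inter> W \<Longrightarrow> t p = (\<Sum>i\<in>UNIV. (b p $ i) *\<^sub>R (f p $ i))"
    using t Wf unfolding smooth_section_def by blast
  have op: "torus_open (U \<inter> W)"
    using atlas_open[OF E Wf] U by (rule torus_open_Int[rotated])
  define c where "c p = (vector [a p$1 * b p$2 - a p$2 * b p$1, a p$1 * b p$3 - a p$3 * b p$1,
     a p$1 * b p$4 - a p$4 * b p$1, a p$2 * b p$3 - a p$3 * b p$2, a p$2 * b p$4 - a p$4 * b p$2,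
     a p$3 * b p$4 - a p$4 * b p$3] :: real^6)" for p
  have minor: "torus_smooth_on (U \<inter> W) (\<lambda>p. a p$i * b p$j - a p$j * b p$i)" for i j
    by (intro torus_smooth_diff torus_smooth_mult torus_smooth_nth op a b)
  have "torus_smooth_on (U \<inter> W) (\<lambda>p. c p $ i)" for i
    using exhaust_6[of i] by (elim disjE) (simp_all add: c_def vector_6 minor)
  then have "torus_smooth_on (U \<inter> W) c"
    by (rule torus_smooth_vec[OF op])
  moreover have "s p \<and>\<^sub>v t p = (\<Sum>i\<in>UNIV. (c p $ i) *\<^sub>R (wedge_basis (f p) $ i))" if "p \<in> U \<inter> W" for p
    unfolding a(2)[OF that] b(2)[OF that] c_def by (rule wedge_expand_4)
  ultimately show ?case unfolding x by blast
qed

lemma smooth_section_add: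
  assumes charts: "\<And>W f. (W, f) \<in> atlas E \<Longrightarrow> torus_open W" and sub: "\<And>p. subspace (fibre E p)"
    and U: "torus_open U" and s: "smooth_section E U s" and t: "smooth_section E U t"
  shows "smooth_section E U (\<lambda>p. s p + t p)"
  unfolding smooth_section_def
proof (intro conjI ballI, goal_cases)
  case (1 p)
  then show ?case using s t sub unfolding smooth_section_def by (intro subspace_add sub) blast+
next
  case (2 x)
  obtain W f where x: "x = (W, f)" by force
  then have Wf: "(W, f) \<in> atlas E" using 2 by simp
  obtain a :: "torus \<Rightarrow> real^'b" where a: "torus_smooth_on (U \<inter> W) a"
    "\<And>p. p \<in> U \<inter> W \<Longrightarrow> s p = (\<Sum>i\<in>UNIV. (a p $ i) *\<^sub>R (f p $ i))"
    using s Wf unfolding smooth_section_def by blast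
  obtain b :: "torus \<Rightarrow> real^'b" where b: "torus_smooth_on (U \<inter> W) b"
    "\<And>p. p \<in> U \<inter> W \<Longrightarrow> t p = (\<Sum>i\<in>UNIV. (b p $ i) *\<^sub>R (f p $ i))"
    using t Wf unfolding smooth_section_def by blast
  have op: "torus_open (U \<inter> W)"
    using charts[OF Wf] U by (rule torus_open_Int[rotated])
  have "torus_smooth_on (U \<inter> W) (\<lambda>p. a p + b p)"
    by (rule torus_smooth_add[OF op a(1) b(1)])
  moreover have "s p + t p = (\<Sum>i\<in>UNIV. ((a p + b p) $ i) *\<^sub>R (f p $ i))" if "p \<in> U \<inter> W" for p
    using a(2)[OF that] b(2)[OF that] by (simp add: scaleR_add_left sum.distrib)
  ultimately show ?case unfolding x by blast
qed

lemma smooth_section_scaleR: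
  assumes charts: "\<And>W f. (W, f) \<in> atlas E \<Longrightarrow> torus_open W" and sub: "\<And>p. subspace (fibre E p)"
    and U: "torus_open U" and s: "smooth_section E U s"
  shows "smooth_section E U (\<lambda>p. r *\<^sub>R s p)"
  unfolding smooth_section_def
proof (intro conjI ballI, goal_cases)
  case (1 p)
  then show ?case using s sub unfolding smooth_section_def by (intro subspace_scale sub) blast+
next
  case (2 x)
  obtain W f where x: "x = (W, f)" by force
  then have Wf: "(W, f) \<in> atlas E" using 2 by simp
  obtain a :: "torus \<Rightarrow> real^'b" where a: "torus_smooth_on (U \<inter> W) a"
    "\<And>p. p \<in> U \<inter> W \<Longrightarrow> s p = (\<Sum>i\<in>UNIV. (a p $ i) *\<^sub>R (f p $ i))"
    using s Wf unfolding smooth_section_def by blast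
  have op: "torus_open (U \<inter> W)"
    using charts[OF Wf] U by (rule torus_open_Int[rotated])
  have "torus_smooth_on (U \<inter> W) (\<lambda>p. r *\<^sub>R a p)"
    by (rule torus_smooth_scaleR[OF op torus_smooth_const[OF op] a(1)])
  moreover have "r *\<^sub>R s p = (\<Sum>i\<in>UNIV. ((r *\<^sub>R a p) $ i) *\<^sub>R (f p $ i))" if "p \<in> U \<inter> W" for p
    using a(2)[OF that] by (simp add: scaleR_sum_right)
  ultimately show ?case unfolding x by blast
qed

lemma connection_add:
  assumes "connection E D" "torus_open U" "smooth_section E U s" "smooth_section E U t" "p \<in> U"
  shows "D w (\<lambda>q. s q + t q) p = D w s p + D w t p"
  using assms unfolding connection_def by blast

lemma connection_scaleR:
  assumes D: "connection E D" and U: "torus_open U" and s: "smooth_section E U s" and p: "pr z \<in> U"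
  shows "D w (\<lambda>q. r *\<^sub>R s q) (pr z) = r *\<^sub>R D w s (pr z)"
proof -
  have "\<forall>f :: torus \<Rightarrow> real. torus_smooth_on U f \<longrightarrow>
           (\<forall>z\<in>pr -` U. \<forall>w. D w (\<lambda>q. f q *\<^sub>R s q) (pr z) =
              frechet_derivative (\<lambda>z. f (pr z)) (at z) w *\<^sub>R s (pr z) + f (pr z) *\<^sub>R D w s (pr z))"
    using D[unfolded connection_def, rule_format, OF U s] by (elim conjE)
  from this[rule_format, OF torus_smooth_const[OF U, of r], of z w] p show ?thesis
    by (simp add: frechet_derivative_const)
qed

text \<open>The three bivectors have the same shape, which allows a uniform treatment.\<close>

lemma Omega_form:
  obtains i j l m where "\<And>\<epsilon> e. Omega \<epsilon> (e :: 'v::real_vector^4) $ k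
     = (1 / sqrt 2) *\<^sub>R (e$i \<and>\<^sub>v e$j + eps_sgn \<epsilon> *\<^sub>R (e$l \<and>\<^sub>v e$m))"
proof -
  have "k = 1 \<or> k = 2 \<or> k = 3" by (rule exhaust_3)
  then show ?thesis
    by (elim disjE) (rule that; simp add: Omega_def)+
qed

lemma bundle_metric_add_right:
  assumes "bundle_metric E h" "subspace (fibre E p)" "u \<in> fibre E p" "v \<in> fibre E p" "w \<in> fibre E p"
  shows "h p w (u + v) = h p w u + h p w v"
  using bundle_metric_add[OF assms(1,3,4,5)] bundle_metric_sym[OF assms(1)] subspace_add[OF assms(2)] assms
  by metis

lemma bundle_metric_scaleR_right:
  assumes "bundle_metric E h" "subspace (fibre E p)" "u \<in> fibre E p" "w \<in> fibre E p"
  shows "h p w (r *\<^sub>R u) = r * h p w u"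
  using bundle_metric_scaleR_sum(2)[OF assms(1,2,4), of "{()}" "\<lambda>_. u" "\<lambda>_. r"] assms(3) by simp

text \<open>The induced metric is a 2 by 2 determinant of values of \<open>h\<close>, to which the Leibniz rule for \<open>h\<close>
applies factor by factor; the result is the Leibniz rule for the induced connection.\<close>

lemma bivector_pairing_derivative:
  fixes E :: "('v::real_vector, 4) vbundle"
  assumes E: "oriented_vector_bundle E" and h: "bundle_metric E h" and D: "metric_connection E h D"
    and hh: "induced_metric E h hh" and DD: "induced_connection E D DD"
    and \<xi>: "parallel_along E D w \<xi>" and \<eta>: "parallel_along E D w \<eta>"
    and U: "torus_open U" "pr (t *\<^sub>R w) \<in> U" and s: "smooth_section E U s" and r: "smooth_section E U r"
  shows "((\<lambda>x. hh (pr (x *\<^sub>R w)) (\<xi> x \<and>\<^sub>v \<eta> x) (s (pr (x *\<^sub>R w)) \<and>\<^sub>v r (pr (x *\<^sub>R w)))) has_real_derivative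
      hh (pr (t *\<^sub>R w)) (\<xi> t \<and>\<^sub>v \<eta> t) (DD w (\<lambda>q. s q \<and>\<^sub>v r q) (pr (t *\<^sub>R w)))) (at t)"
proof -
  let ?\<gamma> = "\<lambda>x. pr (x *\<^sub>R w)"
  let ?p = "?\<gamma> t"
  have conn: "connection E D" using D by (simp add: metric_connection_def)
  have hE: "bundle_metric (Ext2 E) hh" using hh by (simp add: induced_metric_def)
  have formula: "hh p (a \<and>\<^sub>v b) (c \<and>\<^sub>v d) = h p a c * h p b d - h p a d * h p b c"
    if "a \<in> fibre E p" "b \<in> fibre E p" "c \<in> fibre E p" "d \<in> fibre E p" for a b c d p
    using hh that unfolding induced_metric_def by blast
  have fib: "\<xi> x \<in> fibre E (?\<gamma> x)" "\<eta> x \<in> fibre E (?\<gamma> x)" for x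
    using \<xi> \<eta> by (simp_all add: parallel_along_def)
  have sfib: "s p \<in> fibre E p" "r p \<in> fibre E p" if "p \<in> U" for p
    using s r that by (simp_all add: smooth_section_def)
  have Dfib: "D w s ?p \<in> fibre E ?p" "D w r ?p \<in> fibre E ?p"
    using connection_smooth[OF conn U(1) s] connection_smooth[OF conn U(1) r] U(2)
    by (simp_all add: smooth_section_def)
  note K = parallel_pairing_derivative[OF E h D _ U]
  have "((\<lambda>x. h (?\<gamma> x) (\<xi> x) (s (?\<gamma> x)) * h (?\<gamma> x) (\<eta> x) (r (?\<gamma> x))
      - h (?\<gamma> x) (\<xi> x) (r (?\<gamma> x)) * h (?\<gamma> x) (\<eta> x) (s (?\<gamma> x))) has_real_derivative
      (h ?p (\<xi> t) (D w s ?p) * h ?p (\<eta> t) (r ?p) + h ?p (\<eta> t) (D w r ?p) * h ?p (\<xi> t) (s ?p))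
      - (h ?p (\<xi> t) (D w r ?p) * h ?p (\<eta> t) (s ?p) + h ?p (\<eta> t) (D w s ?p) * h ?p (\<xi> t) (r ?p))) (at t)"
    by (intro DERIV_diff DERIV_mult K \<xi> \<eta> s r)
  also have "(h ?p (\<xi> t) (D w s ?p) * h ?p (\<eta> t) (r ?p) + h ?p (\<eta> t) (D w r ?p) * h ?p (\<xi> t) (s ?p))
      - (h ?p (\<xi> t) (D w r ?p) * h ?p (\<eta> t) (s ?p) + h ?p (\<eta> t) (D w s ?p) * h ?p (\<xi> t) (r ?p))
    = hh ?p (\<xi> t \<and>\<^sub>v \<eta> t) (D w s ?p \<and>\<^sub>v r ?p) + hh ?p (\<xi> t \<and>\<^sub>v \<eta> t) (s ?p \<and>\<^sub>v D w r ?p)"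
    by (simp add: formula fib sfib[OF U(2)] Dfib)
  also have "\<dots> = hh ?p (\<xi> t \<and>\<^sub>v \<eta> t) (D w s ?p \<and>\<^sub>v r ?p + s ?p \<and>\<^sub>v D w r ?p)"
    by (intro bundle_metric_add_right[OF hE subspace_Ext2, symmetric] wedge_in_Ext2 fib sfib U Dfib)
  also have "D w s ?p \<and>\<^sub>v r ?p + s ?p \<and>\<^sub>v D w r ?p = DD w (\<lambda>q. s q \<and>\<^sub>v r q) ?p"
    using DD[unfolded induced_connection_def, THEN conjunct2, rule_format, of U s r ?p w] U s r by simp
  finally show ?thesis
  proof (rule DERIV_cong_ev[OF refl _ refl, THEN iffD1, rotated])
    show "\<forall>\<^sub>F x in nhds t. h (?\<gamma> x) (\<xi> x) (s (?\<gamma> x)) * h (?\<gamma> x) (\<eta> x) (r (?\<gamma> x))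
      - h (?\<gamma> x) (\<xi> x) (r (?\<gamma> x)) * h (?\<gamma> x) (\<eta> x) (s (?\<gamma> x))
      = hh (?\<gamma> x) (\<xi> x \<and>\<^sub>v \<eta> x) (s (?\<gamma> x) \<and>\<^sub>v r (?\<gamma> x))"
      using line_stays_in[OF U] by eventually_elim (simp add: formula fib sfib)
  qed
qed

lemma Omega_pairing_derivative:
  fixes E :: "('v::real_vector, 4) vbundle"
  assumes E: "oriented_vector_bundle E" and h: "bundle_metric E h" and D: "metric_connection E h D"
    and hh: "induced_metric E h hh" and DD: "induced_connection E D DD"
    and \<xi>: "parallel_along E D w \<xi>" and \<eta>: "parallel_along E D w \<eta>"
    and U: "torus_open U" "pr (t *\<^sub>R w) \<in> U" and e: "\<And>i. smooth_section E U (\<lambda>p. e p $ i)"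
  shows "((\<lambda>x. hh (pr (x *\<^sub>R w)) (\<xi> x \<and>\<^sub>v \<eta> x) (Omega \<epsilon> (e (pr (x *\<^sub>R w))) $ k)) has_real_derivative
      hh (pr (t *\<^sub>R w)) (\<xi> t \<and>\<^sub>v \<eta> t) (DD w (\<lambda>q. Omega \<epsilon> (e q) $ k) (pr (t *\<^sub>R w)))) (at t)"
    and "smooth_section (Ext2 E) U (\<lambda>p. Omega \<epsilon> (e p) $ k)"
proof -
  let ?\<gamma> = "\<lambda>x. pr (x *\<^sub>R w)"
  let ?p = "?\<gamma> t"
  let ?\<sigma> = "eps_sgn \<epsilon>"
  obtain i j l m where form: "\<And>(e :: 'v^4). Omega \<epsilon> e $ k
     = (1 / sqrt 2) *\<^sub>R (e$i \<and>\<^sub>v e$j + ?\<sigma> *\<^sub>R (e$l \<and>\<^sub>v e$m))"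
    using Omega_form[of k] by metis
  have hE: "bundle_metric (Ext2 E) hh" using hh by (simp add: induced_metric_def)
  have conn: "connection (Ext2 E) DD" using DD by (simp add: induced_connection_def)
  have charts: "torus_open W" if "(W, f) \<in> atlas (Ext2 E)" for W f
    using that atlas_open[OF E] by (auto simp: Ext2_def)
  let ?a = "\<lambda>p. e p $ i \<and>\<^sub>v e p $ j" and ?b = "\<lambda>p. e p $ l \<and>\<^sub>v e p $ m"
  have a: "smooth_section (Ext2 E) U ?a" and b: "smooth_section (Ext2 E) U ?b"
    by (intro smooth_section_wedge E U e)+
  have b': "smooth_section (Ext2 E) U (\<lambda>p. ?\<sigma> *\<^sub>R ?b p)"
    by (intro smooth_section_scaleR charts subspace_Ext2 U b)
  have ab: "smooth_section (Ext2 E) U (\<lambda>p. ?a p + ?\<sigma> *\<^sub>R ?b p)"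
    by (intro smooth_section_add charts subspace_Ext2 U a b')
  show "smooth_section (Ext2 E) U (\<lambda>p. Omega \<epsilon> (e p) $ k)"
    unfolding form by (intro smooth_section_scaleR charts subspace_Ext2 U ab)
  have DDform: "DD w (\<lambda>q. Omega \<epsilon> (e q) $ k) ?p = (1 / sqrt 2) *\<^sub>R (DD w ?a ?p + ?\<sigma> *\<^sub>R DD w ?b ?p)"
    unfolding form
    by (subst connection_scaleR[OF conn U(1) ab U(2)], subst connection_add[OF conn U(1) a b' U(2)],
        subst connection_scaleR[OF conn U(1) b U(2)]) (rule refl)
  have in1: "\<xi> x \<and>\<^sub>v \<eta> x \<in> fibre (Ext2 E) (?\<gamma> x)" for x
    using \<xi> \<eta> by (simp add: parallel_along_def wedge_in_Ext2)
  have in2: "?a p \<in> fibre (Ext2 E) p" "?b p \<in> fibre (Ext2 E) p" if "p \<in> U" for p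
    using a b that by (auto simp: smooth_section_def)
  have in3: "DD w ?a ?p \<in> fibre (Ext2 E) ?p" "DD w ?b ?p \<in> fibre (Ext2 E) ?p"
    using connection_smooth[OF conn U(1) a] connection_smooth[OF conn U(1) b] U(2)
    by (simp_all add: smooth_section_def)
  have lin: "hh p X ((1 / sqrt 2) *\<^sub>R (Y + ?\<sigma> *\<^sub>R Z)) = (1 / sqrt 2) * (hh p X Y + ?\<sigma> * hh p X Z)"
    if "X \<in> fibre (Ext2 E) p" "Y \<in> fibre (Ext2 E) p" "Z \<in> fibre (Ext2 E) p" for p X Y Z
    using that
    by (simp add: subspace_add[OF subspace_Ext2] subspace_scale[OF subspace_Ext2] bundle_metric_add_right[OF hE subspace_Ext2] bundle_metric_scaleR_right[OF hE subspace_Ext2])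
  have "((\<lambda>x. (1 / sqrt 2) * (hh (?\<gamma> x) (\<xi> x \<and>\<^sub>v \<eta> x) (?a (?\<gamma> x)) + ?\<sigma> * hh (?\<gamma> x) (\<xi> x \<and>\<^sub>v \<eta> x) (?b (?\<gamma> x))))
    has_real_derivative (1 / sqrt 2) * (hh ?p (\<xi> t \<and>\<^sub>v \<eta> t) (DD w ?a ?p) + ?\<sigma> * hh ?p (\<xi> t \<and>\<^sub>v \<eta> t) (DD w ?b ?p))) (at t)"
    by (intro DERIV_cmult DERIV_add bivector_pairing_derivative[OF E h D hh DD \<xi> \<eta> U] e)
  then have "((\<lambda>x. (1 / sqrt 2) * (hh (?\<gamma> x) (\<xi> x \<and>\<^sub>v \<eta> x) (?a (?\<gamma> x)) + ?\<sigma> * hh (?\<gamma> x) (\<xi> x \<and>\<^sub>v \<eta> x) (?b (?\<gamma> x))))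
    has_real_derivative hh ?p (\<xi> t \<and>\<^sub>v \<eta> t) (DD w (\<lambda>q. Omega \<epsilon> (e q) $ k) ?p)) (at t)"
    unfolding DDform by (simp only: lin in1 in3)
  then show "((\<lambda>x. hh (?\<gamma> x) (\<xi> x \<and>\<^sub>v \<eta> x) (Omega \<epsilon> (e (?\<gamma> x)) $ k)) has_real_derivative
      hh ?p (\<xi> t \<and>\<^sub>v \<eta> t) (DD w (\<lambda>q. Omega \<epsilon> (e q) $ k) ?p)) (at t)"
  proof (rule DERIV_cong_ev[OF refl _ refl, THEN iffD1, rotated])
    show "\<forall>\<^sub>F x in nhds t. (1 / sqrt 2) * (hh (?\<gamma> x) (\<xi> x \<and>\<^sub>v \<eta> x) (?a (?\<gamma> x)) + ?\<sigma> * hh (?\<gamma> x) (\<xi> x \<and>\<^sub>v \<eta> x) (?b (?\<gamma> x)))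
      = hh (?\<gamma> x) (\<xi> x \<and>\<^sub>v \<eta> x) (Omega \<epsilon> (e (?\<gamma> x)) $ k)"
      using line_stays_in[OF U] by eventually_elim (simp only: form lin in1 in2)
  qed
qed

text \<open>The derivative of the pairing vanishes: \<open>X\<close> is a combination of the bivectors \<open>Omega\<close> of a smooth
orthonormal frame of \<open>E\<close>, the pairing of \<open>\<xi> \<and>\<^sub>v \<eta>\<close> with these is differentiated by the previous lemma,
and the sum is the pairing of \<open>\<xi> \<and>\<^sub>v \<eta>\<close> with the covariant derivative of \<open>X\<close>.\<close>

lemma parallel_bivector_pairing_constant:
  fixes E :: "('v::real_vector, 4) vbundle"
  assumes E: "oriented_vector_bundle E" and h: "bundle_metric E h" and D: "metric_connection E h D"
    and hh: "induced_metric E h hh" and DD: "induced_connection E D DD"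
    and \<xi>: "parallel_along E D w \<xi>" and \<eta>: "parallel_along E D w \<eta>"
    and X: "parallel_along (Ext2_eps \<epsilon> E h) DD w X"
  shows "hh (pr (t *\<^sub>R w)) (\<xi> t \<and>\<^sub>v \<eta> t) (X t) = hh (pr 0) (\<xi> 0 \<and>\<^sub>v \<eta> 0) (X 0)"
proof -
  let ?\<gamma> = "\<lambda>x. pr (x *\<^sub>R w)"
  let ?F = "\<lambda>x. hh (?\<gamma> x) (\<xi> x \<and>\<^sub>v \<eta> x) (X x)"
  have hE: "bundle_metric (Ext2 E) hh" using hh by (simp add: induced_metric_def)
  have conn: "connection (Ext2 E) DD" using DD by (simp add: induced_connection_def)
  have in1: "\<xi> x \<and>\<^sub>v \<eta> x \<in> fibre (Ext2 E) (?\<gamma> x)" for x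
    using \<xi> \<eta> by (simp add: parallel_along_def wedge_in_Ext2)
  have "(?F has_real_derivative 0) (at t)" for t
  proof -
    let ?p = "?\<gamma> t"
    obtain U f c c' where Uf: "(U, f) \<in> atlas (Ext2_eps \<epsilon> E h)" and U: "?p \<in> U"
      and c: "\<And>x. ?\<gamma> x \<in> U \<Longrightarrow> X x = (\<Sum>i\<in>UNIV. (c x $ i) *\<^sub>R (f (?\<gamma> x) $ i))"
      and c': "(c has_vector_derivative c') (at t)"
      and par: "(\<Sum>i\<in>UNIV. (c' $ i) *\<^sub>R (f ?p $ i) + (c t $ i) *\<^sub>R DD w (\<lambda>p. f p $ i) ?p) = 0"
      using X unfolding parallel_along_def by blast
    obtain e where f: "f = (\<lambda>p. Omega \<epsilon> (e p))" and e: "positive_orthonormal_frame E h U e"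
      using Uf by (auto simp: Ext2_eps_def)
    have op: "torus_open U" and sm: "\<And>i. smooth_section E U (\<lambda>p. e p $ i)"
      using e by (auto simp: positive_orthonormal_frame_def)
    note deriv = Omega_pairing_derivative[OF E h D hh DD \<xi> \<eta> op U sm, where \<epsilon> = \<epsilon>, folded f]
    have ffib: "f p $ i \<in> fibre (Ext2 E) p" if "p \<in> U" for p i
      using deriv(2)[of i] that by (simp add: smooth_section_def f)
    have Dfib: "DD w (\<lambda>p. f p $ i) ?p \<in> fibre (Ext2 E) ?p" for i
      using connection_smooth[OF conn op deriv(2)[of i]] U by (simp add: smooth_section_def f)
    have ci: "((\<lambda>x. c x $ i) has_real_derivative c' $ i) (at t)" for i
      using bounded_linear.has_vector_derivative[OF bounded_linear_vec_nth c']
      by (simp add: has_real_derivative_iff_has_vector_derivative)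
    let ?h = "\<lambda>x. hh (?\<gamma> x) (\<xi> x \<and>\<^sub>v \<eta> x)"
    have "((\<lambda>x. \<Sum>i\<in>UNIV. c x $ i * ?h x (f (?\<gamma> x) $ i)) has_real_derivative
        (\<Sum>i\<in>UNIV. c' $ i * ?h t (f ?p $ i) + ?h t (DD w (\<lambda>p. f p $ i) ?p) * c t $ i)) (at t)"
      by (intro DERIV_sum DERIV_mult ci) (use deriv(1) in \<open>simp add: f\<close>)
    also have "(\<Sum>i\<in>UNIV. c' $ i * ?h t (f ?p $ i) + ?h t (DD w (\<lambda>p. f p $ i) ?p) * c t $ i)
       = (\<Sum>i\<in>UNIV. ?h t (c' $ i *\<^sub>R f ?p $ i + c t $ i *\<^sub>R DD w (\<lambda>p. f p $ i) ?p))"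
      by (intro sum.cong refl)
         (simp add: ffib[OF U] Dfib in1 subspace_scale[OF subspace_Ext2] bundle_metric_add_right[OF hE subspace_Ext2] bundle_metric_scaleR_right[OF hE subspace_Ext2])
    also have "\<dots> = ?h t (\<Sum>i\<in>UNIV. 1 *\<^sub>R (c' $ i *\<^sub>R f ?p $ i + c t $ i *\<^sub>R DD w (\<lambda>p. f p $ i) ?p))"
      by (subst bundle_metric_scaleR_sum(2)[OF hE subspace_Ext2])
         (auto intro!: in1 subspace_add subspace_scale subspace_Ext2 ffib U Dfib)
    also have "\<dots> = hh ?p 0 (\<xi> t \<and>\<^sub>v \<eta> t)"
      using par bundle_metric_sym[OF hE in1 subspace_0[OF subspace_Ext2]] by simp
    also have "\<dots> = 0"
      by (rule bundle_metric_zero[OF hE subspace_Ext2 in1])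
    finally show ?thesis
    proof (rule DERIV_cong_ev[OF refl _ refl, THEN iffD1, rotated])
      show "\<forall>\<^sub>F x in nhds t. (\<Sum>i\<in>UNIV. c x $ i * ?h x (f (?\<gamma> x) $ i)) = ?F x"
        using line_stays_in[OF op U]
      proof eventually_elim
        case (elim x)
        then show ?case
          unfolding c[OF elim] by (intro bundle_metric_scaleR_sum(2)[OF hE subspace_Ext2, symmetric] in1 ffib)
      qed
    qed
  qed
  then have "?F t = ?F 0"
    by (intro DERIV_isconst_all[of ?F t 0] allI)
  then show ?thesis by simp
qed

section \<open>Holonomy on bivectors as conjugation by the holonomy\<close>

lemma row_mult_mult: "row_mult (row_mult b A) B = row_mult (b :: 'v::real_vector^'n) (A ** B)"
proof -
  have "row_mult (row_mult b A) B $ j = row_mult b (A ** B) $ j" for j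
  proof -
    have "row_mult (row_mult b A) B $ j = (\<Sum>i\<in>UNIV. \<Sum>k\<in>UNIV. (A $ k $ i * B $ i $ j) *\<^sub>R b $ k)"
      by (simp add: row_mult_def scaleR_sum_right mult.commute)
    also have "\<dots> = (\<Sum>k\<in>UNIV. \<Sum>i\<in>UNIV. (A $ k $ i * B $ i $ j) *\<^sub>R b $ k)"
      by (rule sum.swap)
    finally show ?thesis
      by (simp add: row_mult_def matrix_matrix_mult_def scaleR_sum_left)
  qed
  then show ?thesis by (simp add: vec_eq_iff)
qed

lemma positive_basis_in_fibre:
  assumes "oriented_vector_bundle E" "positive_basis E p b"
  shows "b $ i \<in> fibre E p"
proof -
  obtain U e M where "(U, e) \<in> atlas E" "p \<in> U" "b = row_mult (e p) M"
    using assms(2) unfolding positive_basis_def by blast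
  then show ?thesis
    unfolding row_mult_def
    by (auto intro!: subspace_sum subspace_scale fibre_subspace[OF assms(1)] frame_in_fibre[OF assms(1)])
qed

text \<open>Two positive bases differ by a matrix of positive determinant, and the orthonormality of both makes it
orthogonal.\<close>

lemma positive_orthonormal_bases_rotation:
  fixes b b' :: "'v::real_vector^'n::finite"
  assumes E: "oriented_vector_bundle E" and h: "bundle_metric E h"
    and b: "positive_orthonormal_basis E h p b" and b': "positive_orthonormal_basis E h p b'"
  obtains R where "rotation_matrix R" "b = row_mult b' R"
proof -
  obtain U e M where M: "(U, e) \<in> atlas E" "p \<in> U" "b = row_mult (e p) M" "det M > 0"
    using b unfolding positive_orthonormal_basis_def positive_basis_def by blast
  obtain W f N where N: "(W, f) \<in> atlas E" "p \<in> W" "b' = row_mult (f p) N" "det N > 0"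
    using b' unfolding positive_orthonormal_basis_def positive_basis_def by blast
  obtain g :: "torus \<Rightarrow> real^'n^'n" where g: "e p = row_mult (f p) (g p)" "det (g p) > 0"
    using atlas_transition[OF E N(1) M(1)] M(2) N(2) by (metis IntI)
  have "invertible N"
    using N(4) by (simp add: invertible_det_nz)
  then obtain N' where inv: "N ** N' = mat 1" "N' ** N = mat 1"
    unfolding invertible_def by blast
  then have "det N * det (N') = 1"
    by (metis det_I det_mul)
  then have dinv: "det (N') > 0"
    using N(4) by (metis zero_less_mult_pos zero_less_one)
  define R where "R = N' ** g p ** M"
  have eq: "b = row_mult b' R"
    by (simp add: M(3) N(3) g(1) R_def row_mult_mult matrix_mul_assoc inv)
  have fib: "b' $ i \<in> fibre E p" for i
    using positive_basis_in_fibre[OF E] b' by (auto simp: positive_orthonormal_basis_def)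
  have bfib: "b $ i \<in> fibre E p" for i
    using positive_basis_in_fibre[OF E] b by (auto simp: positive_orthonormal_basis_def)
  have "transpose R ** R = mat 1"
  proof -
    have "(transpose R ** R) $ i $ j = mat 1 $ i $ j" for i j
    proof -
      have "h p (b $ i) (b $ j) = (\<Sum>k\<in>UNIV. R $ k $ i * h p (b' $ k) (b $ j))"
        unfolding eq[THEN arg_cong, of "\<lambda>x. x $ i"] unfolding row_mult_def vec_lambda_beta
        by (rule bundle_metric_scaleR_sum(1)[OF h fibre_subspace[OF E]])
           (use bfib fib in \<open>auto simp: row_mult_def\<close>)
      also have "\<dots> = (\<Sum>k\<in>UNIV. R $ k $ i * R $ k $ j)"
      proof (intro sum.cong refl arg_cong2[where f = "(*)"])
        fix k
        have "h p (b' $ k) (b $ j) = (\<Sum>l\<in>UNIV. R $ l $ j * h p (b' $ k) (b' $ l))"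
          unfolding eq row_mult_def vec_lambda_beta
          by (rule bundle_metric_scaleR_sum(2)[OF h fibre_subspace[OF E]]) (use fib in auto)
        also have "\<dots> = (\<Sum>l\<in>UNIV. if k = l then R $ l $ j else 0)"
          using b' by (intro sum.cong) (auto simp: positive_orthonormal_basis_def)
        finally show "h p (b' $ k) (b $ j) = R $ k $ j" by simp
      qed
      finally show ?thesis
        using b by (simp add: positive_orthonormal_basis_def matrix_matrix_mult_def transpose_def mat_def)
    qed
    then show ?thesis by (simp add: vec_eq_iff)
  qed
  then have "orthogonal_matrix R" by (simp add: orthogonal_matrix)
  moreover have "det R > 0"
    using M(4) g(2) dinv by (simp add: R_def det_mul)
  ultimately have "rotation_matrix R"
    using det_orthogonal_matrix[of R] by (auto simp: rotation_matrix_def)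
  then show ?thesis using eq by (rule that)
qed

lemma wedge_sum:
  fixes u v :: "'v::real_vector^4"
  shows "(\<Sum>m\<in>UNIV. x m *\<^sub>R u $ m) \<and>\<^sub>v (\<Sum>n\<in>UNIV. y n *\<^sub>R v $ n)
    = (\<Sum>m\<in>UNIV. \<Sum>n\<in>UNIV. (x m * y n) *\<^sub>R (u $ m \<and>\<^sub>v v $ n))"
  by (intro ext) (simp add: sum_4 wedge_apply algebra_simps)

text \<open>For an orthonormal basis \<open>b\<close> this is the skew matrix of the coefficients of the bivector \<open>X\<close>.\<close>

definition pairing_matrix ::
  "(torus \<Rightarrow> 'v::real_vector bivector \<Rightarrow> 'v bivector \<Rightarrow> real) \<Rightarrow> torus \<Rightarrow> 'v^4 \<Rightarrow> 'v bivector \<Rightarrow> real^4^4" where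
  "pairing_matrix hh p b X = (\<chi> i j. hh p (b $ i \<and>\<^sub>v b $ j) X)"

lemma pairing_matrix_row_mult:
  assumes hh: "bundle_metric (Ext2 E) hh" and b: "\<And>i. b $ i \<in> fibre E p" and X: "X \<in> fibre (Ext2 E) p"
  shows "pairing_matrix hh p (row_mult b A) X = transpose A ** pairing_matrix hh p b X ** A"
proof -
  have "pairing_matrix hh p (row_mult b A) X $ i $ j = (transpose A ** pairing_matrix hh p b X ** A) $ i $ j" for i j
  proof -
    have "hh p (row_mult b A $ i \<and>\<^sub>v row_mult b A $ j) X
       = hh p (\<Sum>m\<in>UNIV. 1 *\<^sub>R (\<Sum>n\<in>UNIV. (A$m$i * A$n$j) *\<^sub>R (b $ m \<and>\<^sub>v b $ n))) X"
      by (simp add: row_mult_def wedge_sum)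
    also have "\<dots> = (\<Sum>m\<in>UNIV. hh p (\<Sum>n\<in>UNIV. (A$m$i * A$n$j) *\<^sub>R (b $ m \<and>\<^sub>v b $ n)) X)"
      by (subst bundle_metric_scaleR_sum(1)[OF hh subspace_Ext2 X])
         (auto intro!: subspace_sum subspace_scale subspace_Ext2 wedge_in_Ext2 b)
    also have "\<dots> = (\<Sum>m\<in>UNIV. \<Sum>n\<in>UNIV. (A$m$i * A$n$j) * hh p (b $ m \<and>\<^sub>v b $ n) X)"
      by (intro sum.cong refl bundle_metric_scaleR_sum(1)[OF hh subspace_Ext2 X] wedge_in_Ext2 b)
    also have "\<dots> = (transpose A ** pairing_matrix hh p b X ** A) $ i $ j"
      by (simp add: pairing_matrix_def matrix_matrix_mult_def transpose_def sum_4 algebra_simps)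
    finally show ?thesis by (simp add: pairing_matrix_def)
  qed
  then show ?thesis by (simp add: vec_eq_iff)
qed

lemma pairing_matrix_sum:
  assumes hh: "bundle_metric (Ext2 E) hh" and b: "\<And>i. b $ i \<in> fibre E p"
    and X: "\<And>k. X k \<in> fibre (Ext2 E) p"
  shows "pairing_matrix hh p b (\<Sum>k\<in>I. c k *\<^sub>R X k) = (\<Sum>k\<in>I. c k *\<^sub>R pairing_matrix hh p b (X k))"
  using bundle_metric_scaleR_sum(2)[OF hh subspace_Ext2 wedge_in_Ext2[OF b b], where I = I and u = X and a = c] X
  by (simp add: pairing_matrix_def vec_eq_iff)

lemma Omega_in_Ext2:
  assumes "\<And>i. b $ i \<in> fibre E p"
  shows "Omega \<epsilon> b $ k \<in> fibre (Ext2 E) p"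
proof -
  obtain i j l m where "Omega \<epsilon> b $ k = (1 / sqrt 2) *\<^sub>R (b$i \<and>\<^sub>v b$j + eps_sgn \<epsilon> *\<^sub>R (b$l \<and>\<^sub>v b$m))"
    using Omega_form[of k] by metis
  then show ?thesis
    by (simp only:) (intro subspace_add subspace_scale subspace_Ext2 wedge_in_Ext2 assms)
qed

lemma pairing_matrix_Omega:
  assumes hh: "induced_metric E h hh" and sub: "subspace (fibre E p)" and b: "\<And>i. b $ i \<in> fibre E p"
    and on: "\<And>i j. h p (b $ i) (b $ j) = (if i = j then 1 else 0)"
  shows "pairing_matrix hh p b (Omega \<epsilon> b $ k) = (1 / sqrt 2) *\<^sub>R kap (eps_sgn \<epsilon>) (axis k 1)"
proof -
  have hE: "bundle_metric (Ext2 E) hh" using hh by (simp add: induced_metric_def)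
  have w: "hh p (b $ i \<and>\<^sub>v b $ j) (b $ l \<and>\<^sub>v b $ m) =
      (if i = l \<and> j = m then 1 else 0) - (if i = m \<and> j = l then 1 else 0)" for i j l m
  proof -
    have "hh p (b $ i \<and>\<^sub>v b $ j) (b $ l \<and>\<^sub>v b $ m)
        = h p (b $ i) (b $ l) * h p (b $ j) (b $ m) - h p (b $ i) (b $ m) * h p (b $ j) (b $ l)"
      using hh[unfolded induced_metric_def, THEN conjunct2, rule_format, OF b b b b] .
    then show ?thesis
      unfolding on by (cases "i = l"; cases "j = m"; cases "i = m"; cases "j = l") simp_all
  qed
  have lin: "hh p (b $ i \<and>\<^sub>v b $ j) ((1 / sqrt 2) *\<^sub>R (b$l \<and>\<^sub>v b$m + \<sigma> *\<^sub>R (b$n \<and>\<^sub>v b$r)))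
     = (1 / sqrt 2) * (hh p (b $ i \<and>\<^sub>v b $ j) (b$l \<and>\<^sub>v b$m) + \<sigma> * hh p (b $ i \<and>\<^sub>v b $ j) (b$n \<and>\<^sub>v b$r))"
    for i j l m n r \<sigma>
    by (simp add: subspace_add[OF subspace_Ext2] subspace_scale[OF subspace_Ext2] wedge_in_Ext2 b
      bundle_metric_add_right[OF hE subspace_Ext2] bundle_metric_scaleR_right[OF hE subspace_Ext2])
  have entry: "pairing_matrix hh p b ((1 / sqrt 2) *\<^sub>R (b$l \<and>\<^sub>v b$m + \<sigma> *\<^sub>R (b$n \<and>\<^sub>v b$r))) $ i $ j
     = (1 / sqrt 2) * ((if i = l \<and> j = m then 1 else 0) - (if i = m \<and> j = l then 1 else 0)
         + \<sigma> * ((if i = n \<and> j = r then 1 else 0) - (if i = r \<and> j = n then 1 else 0)))"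
    for i j l m n r \<sigma>
    unfolding pairing_matrix_def vec_lambda_beta lin w ..
  have Om: "Omega \<epsilon> b $ 1 = (1 / sqrt 2) *\<^sub>R (b$1 \<and>\<^sub>v b$2 + eps_sgn \<epsilon> *\<^sub>R (b$3 \<and>\<^sub>v b$4))"
    "Omega \<epsilon> b $ 2 = (1 / sqrt 2) *\<^sub>R (b$1 \<and>\<^sub>v b$3 + eps_sgn \<epsilon> *\<^sub>R (b$4 \<and>\<^sub>v b$2))"
    "Omega \<epsilon> b $ 3 = (1 / sqrt 2) *\<^sub>R (b$1 \<and>\<^sub>v b$4 + eps_sgn \<epsilon> *\<^sub>R (b$2 \<and>\<^sub>v b$3))"
    unfolding Omega_def by (rule vector_3)+
  have "pairing_matrix hh p b (Omega \<epsilon> b $ k) $ i $ j = ((1 / sqrt 2) *\<^sub>R kap (eps_sgn \<epsilon>) (axis k 1)) $ i $ j" for i j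
  proof -
    consider "k = 1" | "k = 2" | "k = 3" using exhaust_3[of k] by blast
    then show ?thesis
    proof cases
      case 1
      show ?thesis unfolding 1 Om entry
        using exhaust_4[of i] exhaust_4[of j] by (elim disjE) (simp_all add: axis_def)
    next
      case 2
      show ?thesis unfolding 2 Om entry
        using exhaust_4[of i] exhaust_4[of j] by (elim disjE) (simp_all add: axis_def)
    next
      case 3
      show ?thesis unfolding 3 Om entry
        using exhaust_4[of i] exhaust_4[of j] by (elim disjE) (simp_all add: axis_def)
    qed
  qed
  then show ?thesis by (simp add: vec_eq_iff)
qed

text \<open>The value of the constant pairing at the parameter \<open>0\<close> involves \<open>b\<close> and \<open>\<omega>\<close>, its value at \<open>2 * pi\<close>
involves \<open>row_mult b A\<close> and \<open>row_mult \<omega> C\<close>.\<close>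

lemma holonomy_pairing_conj:
  fixes E :: "('v::real_vector, 4) vbundle"
  assumes E: "oriented_vector_bundle E" and h: "bundle_metric E h" and D: "metric_connection E h D"
    and hh: "induced_metric E h hh" and DD: "induced_connection E D DD"
    and w: "pr ((2 * pi) *\<^sub>R w) = pr 0"
    and A: "holonomy_matrix E D w b A" and C: "holonomy_matrix (Ext2_eps \<epsilon> E h) DD w \<omega> C"
    and b: "\<And>i. b $ i \<in> fibre E (pr 0)" and \<omega>: "\<And>i. \<omega> $ i \<in> fibre (Ext2 E) (pr 0)"
  shows "A ** pairing_matrix hh (pr 0) b (\<omega> $ k) ** transpose A
    = (\<Sum>l\<in>UNIV. C $ l $ k *\<^sub>R pairing_matrix hh (pr 0) b (\<omega> $ l))"
proof -
  have hE: "bundle_metric (Ext2 E) hh" using hh by (simp add: induced_metric_def)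
  \<comment> \<open>the parallel frames are shifted by a full period from the parameter 0\<close>
  obtain \<xi> where \<xi>: "\<xi> 0 = b" "\<And>i. parallel_along E D w (\<lambda>t. \<xi> t $ i)" "\<xi> (0 + 2 * pi) = row_mult (\<xi> 0) A"
    using A unfolding holonomy_matrix_def by metis
  obtain X where X: "X 0 = \<omega>" "\<And>i. parallel_along (Ext2_eps \<epsilon> E h) DD w (\<lambda>t. X t $ i)"
     "X (0 + 2 * pi) = row_mult (X 0) C"
    using C unfolding holonomy_matrix_def by metis
  have oA: "transpose A ** A = mat 1" "A ** transpose A = mat 1"
    using A by (auto simp: holonomy_matrix_def rotation_matrix_def orthogonal_matrix_def)
  let ?T = "pairing_matrix hh (pr 0) b"
  have "hh (pr 0) (row_mult b A $ i \<and>\<^sub>v row_mult b A $ j) (row_mult \<omega> C $ k)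
      = hh (pr 0) (b $ i \<and>\<^sub>v b $ j) (\<omega> $ k)" for i j
    using parallel_bivector_pairing_constant[OF E h D hh DD \<xi>(2)[of i] \<xi>(2)[of j] X(2)[of k], of "2 * pi"]
      \<xi>(3) X(3) by (simp add: w \<xi>(1) X(1))
  then have "pairing_matrix hh (pr 0) (row_mult b A) (row_mult \<omega> C $ k) = ?T (\<omega> $ k)"
    by (simp add: pairing_matrix_def)
  moreover have "row_mult \<omega> C $ k \<in> fibre (Ext2 E) (pr 0)"
    unfolding row_mult_def by (auto intro!: subspace_sum subspace_scale subspace_Ext2 \<omega>)
  ultimately have "?T (\<omega> $ k) = transpose A ** ?T (row_mult \<omega> C $ k) ** A"
    using pairing_matrix_row_mult[OF hE b] by metis
  then have "A ** ?T (\<omega> $ k) ** transpose A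
     = (A ** transpose A) ** ?T (row_mult \<omega> C $ k) ** (A ** transpose A)"
    by (simp only: matrix_mul_assoc)
  also have "\<dots> = ?T (row_mult \<omega> C $ k)"
    by (simp add: oA)
  also have "\<dots> = (\<Sum>l\<in>UNIV. C $ l $ k *\<^sub>R ?T (\<omega> $ l))"
    unfolding row_mult_def vec_lambda_beta
    by (rule pairing_matrix_sum[OF hE b \<omega>])
  finally show ?thesis .
qed

lemma eps_sgn_cases: "eps_sgn \<epsilon> = 1 \<or> eps_sgn \<epsilon> = -1"
  by (cases \<epsilon>) auto

text \<open>Linear extension of the pairing matrices of \<open>\<omega>\<close> with respect to \<open>b\<close> gives a map \<open>S\<close> which intertwines
the action of \<open>C\<close> with the conjugation by \<open>A\<close>. Its values are of the form \<open>kap\<close> because \<open>\<omega>\<close> is a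
combination of bivectors \<open>Omega\<close> in another positive orthonormal basis \<open>b'\<close>, and passing from \<open>b'\<close> to
\<open>b\<close> is conjugation by a rotation.\<close>

lemma holonomy_conjugation:
  fixes E :: "('v::real_vector, 4) vbundle"
  assumes E: "oriented_vector_bundle E" and h: "bundle_metric E h" and D: "metric_connection E h D"
    and hh: "induced_metric E h hh" and DD: "induced_connection E D DD"
    and A: "holonomy_generators E h D b A\<^sub>1 A\<^sub>2"
    and C: "holonomy_generators (Ext2_eps \<epsilon> E h) hh DD \<omega> C\<^sub>1 C\<^sub>2"
  obtains P where "linear P" "inj P"
    "\<And>v. A\<^sub>1 ** kap (eps_sgn \<epsilon>) (P v) ** transpose A\<^sub>1 = kap (eps_sgn \<epsilon>) (P (C\<^sub>1 *v v))"
    "\<And>v. A\<^sub>2 ** kap (eps_sgn \<epsilon>) (P v) ** transpose A\<^sub>2 = kap (eps_sgn \<epsilon>) (P (C\<^sub>2 *v v))"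
proof -
  have hE: "bundle_metric (Ext2 E) hh" using hh by (simp add: induced_metric_def)
  have pr0: "pr (0, 0) = pr 0" by (simp add: zero_prod_def)
  have b: "positive_orthonormal_basis E h (pr 0) b"
    using A by (simp add: holonomy_generators_def pr0)
  have bfib: "b $ i \<in> fibre E (pr 0)" for i
    using positive_basis_in_fibre[OF E] b by (auto simp: positive_orthonormal_basis_def)
  have "positive_basis (Ext2_eps \<epsilon> E h) (pr 0) \<omega>"
    using C by (simp add: holonomy_generators_def positive_orthonormal_basis_def pr0)
  then obtain U e M where e: "positive_orthonormal_frame E h U e" "pr 0 \<in> U"
    and \<omega>M: "\<omega> = row_mult (Omega \<epsilon> (e (pr 0))) M" and M: "det M > 0"
    by (auto simp: positive_basis_def Ext2_eps_def)
  define b' where "b' = e (pr 0)"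
  have b': "positive_orthonormal_basis E h (pr 0) b'"
    using e by (simp add: positive_orthonormal_frame_def b'_def)
  have b'fib: "b' $ i \<in> fibre E (pr 0)" for i
    using positive_basis_in_fibre[OF E] b' by (auto simp: positive_orthonormal_basis_def)
  obtain R where R: "rotation_matrix R" "b = row_mult b' R"
    using positive_orthonormal_bases_rotation[OF E h b b'] .
  have oR: "transpose R ** R = mat 1" "R ** transpose R = mat 1"
    using R(1) by (auto simp: rotation_matrix_def orthogonal_matrix_def)
  have Rt: "rotation_matrix (transpose R)"
    using R(1) by (simp add: rotation_matrix_def orthogonal_matrix_transpose)
  have \<omega>fib: "\<omega> $ i \<in> fibre (Ext2 E) (pr 0)" for i
    unfolding \<omega>M b'_def[symmetric] row_mult_def
    by (auto intro!: subspace_sum subspace_scale subspace_Ext2 Omega_in_Ext2 b'fib)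
  let ?\<kappa> = "kap (eps_sgn \<epsilon>)"
  let ?T = "pairing_matrix hh (pr 0) b"
  define S where "S v = (\<Sum>i\<in>UNIV. v $ i *\<^sub>R ?T (\<omega> $ i))" for v :: "real^3"
  have S: "S v = (1 / sqrt 2) *\<^sub>R (transpose R ** ?\<kappa> (M *v v) ** R)" for v
  proof -
    have \<kappa>_axis: "(\<Sum>k\<in>UNIV. c $ k *\<^sub>R ?\<kappa> (axis k 1)) = ?\<kappa> c" for c
    proof -
      have "c = (\<Sum>k\<in>UNIV. c $ k *\<^sub>R axis k 1)"
        using basis_expansion[of c] by (simp add: scalar_mult_eq_scaleR)
      then have "?\<kappa> c = ?\<kappa> (\<Sum>k\<in>UNIV. c $ k *\<^sub>R axis k 1)" by simp
      then show ?thesis by (simp add: linear_sum[OF linear_kap] linear_cmul[OF linear_kap])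
    qed
    have T\<omega>: "?T (\<omega> $ i) = (1 / sqrt 2) *\<^sub>R (transpose R ** ?\<kappa> (column i M) ** R)" for i
    proof -
      have "?T (\<omega> $ i) = transpose R ** pairing_matrix hh (pr 0) b' (\<omega> $ i) ** R"
        unfolding R(2) by (rule pairing_matrix_row_mult[OF hE b'fib \<omega>fib])
      also have "pairing_matrix hh (pr 0) b' (\<omega> $ i)
          = (\<Sum>k\<in>UNIV. M $ k $ i *\<^sub>R pairing_matrix hh (pr 0) b' (Omega \<epsilon> b' $ k))"
        unfolding \<omega>M b'_def[symmetric] row_mult_def vec_lambda_beta
        by (rule pairing_matrix_sum[OF hE b'fib Omega_in_Ext2[OF b'fib]])
      also have "\<dots> = (\<Sum>k\<in>UNIV. M $ k $ i *\<^sub>R (1 / sqrt 2) *\<^sub>R ?\<kappa> (axis k 1))"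
        using b' by (simp add: pairing_matrix_Omega[OF hh fibre_subspace[OF E] b'fib] positive_orthonormal_basis_def)
      also have "\<dots> = (1 / sqrt 2) *\<^sub>R (\<Sum>k\<in>UNIV. column i M $ k *\<^sub>R ?\<kappa> (axis k 1))"
        by (simp add: scaleR_sum_right column_def mult.commute)
      also have "\<dots> = (1 / sqrt 2) *\<^sub>R ?\<kappa> (column i M)"
        by (simp only: \<kappa>_axis)
      finally show ?thesis by (simp add: mm_simps)
    qed
    have "S v = (1 / sqrt 2) *\<^sub>R (transpose R ** (\<Sum>i\<in>UNIV. v $ i *\<^sub>R ?\<kappa> (column i M)) ** R)"
      unfolding S_def T\<omega>
      by (simp add: mm.sum_left mm.sum_right mm_simps scaleR_sum_right mult.commute)
    also have "(\<Sum>i\<in>UNIV. v $ i *\<^sub>R ?\<kappa> (column i M)) = ?\<kappa> (\<Sum>i\<in>UNIV. v $ i *\<^sub>R column i M)"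
      by (simp add: linear_sum[OF linear_kap] linear_cmul[OF linear_kap])
    also have "(\<Sum>i\<in>UNIV. v $ i *\<^sub>R column i M) = M *v v"
      by (simp add: matrix_mult_sum scalar_mult_eq_scaleR)
    finally show ?thesis .
  qed
  \<comment> \<open>the conjugate by a rotation of a matrix of sign \<epsilon> has sign \<epsilon>\<close>
  have "\<exists>u. S v = ?\<kappa> u" for v
  proof -
    obtain u where "transpose R ** ?\<kappa> (M *v v) ** R = ?\<kappa> u"
      using rotation_conj_kap[OF eps_sgn_cases Rt, of \<epsilon> "M *v v"] by auto
    then have "S v = ?\<kappa> ((1 / sqrt 2) *\<^sub>R u)"
      unfolding S by (simp add: linear_cmul[OF linear_kap])
    then show ?thesis by blast
  qed
  then obtain P where P: "\<And>v. S v = ?\<kappa> (P v)" by metis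
  have linS: "linear S"
    by (rule linearI) (simp_all add: S_def scaleR_add_left sum.distrib scaleR_sum_right)
  have "linear P"
  proof (rule linearI)
    show "P (v + w) = P v + P w" for v w
      by (rule kap_inj[of "eps_sgn \<epsilon>"]) (simp add: P[symmetric] linear_add[OF linear_kap] linear_add[OF linS])
    show "P (c *\<^sub>R v) = c *\<^sub>R P v" for c v
      by (rule kap_inj[of "eps_sgn \<epsilon>"]) (simp add: P[symmetric] linear_cmul[OF linear_kap] linear_cmul[OF linS])
  qed
  moreover have "inj P"
  proof (rule injI)
    fix v w assume "P v = P w"
    then have "S v = S w" by (simp add: P)
    then have "transpose R ** ?\<kappa> (M *v v) ** R = transpose R ** ?\<kappa> (M *v w) ** R"
      by (simp add: S)
    then have "R ** (transpose R ** ?\<kappa> (M *v v) ** R) ** transpose R = R ** (transpose R ** ?\<kappa> (M *v w) ** R) ** transpose R"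
      by simp
    then have "(R ** transpose R) ** ?\<kappa> (M *v v) ** (R ** transpose R) = (R ** transpose R) ** ?\<kappa> (M *v w) ** (R ** transpose R)"
      by (simp only: matrix_mul_assoc)
    then have "M *v v = M *v w"
      unfolding oR matrix_mul_lid matrix_mul_rid by (rule kap_inj)
    moreover have "invertible M"
      using M by (simp add: invertible_det_nz)
    then obtain M' where "M' ** M = mat 1"
      unfolding invertible_def by blast
    ultimately show "v = w"
      by (metis matrix_vector_mul_assoc matrix_vector_mul_lid)
  qed
  moreover have "A ** ?\<kappa> (P v) ** transpose A = ?\<kappa> (P (C *v v))"
    if "holonomy_matrix E D w b A" "holonomy_matrix (Ext2_eps \<epsilon> E h) DD w \<omega> C" "pr ((2 * pi) *\<^sub>R w) = pr 0"
    for A C w v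
  proof -
    have "A ** S v ** transpose A = (\<Sum>i\<in>UNIV. v $ i *\<^sub>R (\<Sum>l\<in>UNIV. C $ l $ i *\<^sub>R ?T (\<omega> $ l)))"
      unfolding S_def mm.sum_left mm.sum_right mm.scaleR_left mm.scaleR_right
        holonomy_pairing_conj[OF E h D hh DD that(3,1,2) bfib \<omega>fib] ..
    also have "\<dots> = S (C *v v)"
      by (simp add: S_def matrix_vector_mult_def sum_3 algebra_simps)
    finally show ?thesis by (simp add: P)
  qed
  moreover have "pr ((2 * pi) *\<^sub>R (1, 0)) = pr 0" "pr ((2 * pi) *\<^sub>R (0, 1)) = pr 0"
  proof -
    have "circle_rel (2 * pi) 0"
      unfolding circle_rel_def by (rule exI[of _ "-1"]) simp
    then have "abs_circle (2 * pi) = abs_circle 0"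
      by (simp add: circle.abs_eq_iff)
    then show "pr ((2 * pi) *\<^sub>R (1, 0)) = pr 0" "pr ((2 * pi) *\<^sub>R (0, 1)) = pr 0"
      by (simp_all add: pr_def)
  qed
  ultimately show ?thesis
    using A C unfolding holonomy_generators_def by (intro that[of P]) blast+
qed

section \<open>Density of the holonomy group\<close>

lemma rotation_matrix_transpose: "rotation_matrix A \<Longrightarrow> rotation_matrix (transpose A)"
  by (simp add: rotation_matrix_def orthogonal_matrix_transpose)

lemma SO_group_group: "group (SO_group :: (real^'n::finite^'n) monoid)"
proof (rule groupI)
  fix A :: "real^'n^'n" assume "A \<in> carrier SO_group"
  then show "\<exists>B\<in>carrier SO_group. B \<otimes>\<^bsub>SO_group\<^esub> A = \<one>\<^bsub>SO_group\<^esub>"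
    by (intro bexI[of _ "transpose A"])
       (auto simp: SO_group_def rotation_matrix_def orthogonal_matrix_def)
qed (auto simp: SO_group_def rotation_matrix_def orthogonal_matrix_mul det_mul
    orthogonal_matrix_id matrix_mul_assoc)

lemma SO_group_inv:
  assumes "rotation_matrix A"
  shows "inv\<^bsub>SO_group\<^esub> A = transpose (A :: real^'n::finite^'n)"
proof (rule group.inv_equality[OF SO_group_group])
  show "transpose A \<otimes>\<^bsub>SO_group\<^esub> A = \<one>\<^bsub>SO_group\<^esub>"
    using assms by (simp add: SO_group_def rotation_matrix_def orthogonal_matrix_def)
qed (use assms rotation_matrix_transpose in \<open>auto simp: SO_group_def\<close>)

lemma closure_matrix_mult:
  fixes G :: "(real^'n^'n) set"
  assumes "\<And>X Y. X \<in> G \<Longrightarrow> Y \<in> G \<Longrightarrow> X ** Y \<in> G" "X \<in> closure G" "Y \<in> closure G"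
  shows "X ** Y \<in> closure G"
proof -
  obtain x y where "\<forall>n. x n \<in> G" "x \<longlonglongrightarrow> X" "\<forall>n. y n \<in> G" "y \<longlonglongrightarrow> Y"
    using assms(2,3) by (auto simp: closure_sequential)
  then show ?thesis
    unfolding closure_sequential
    by (intro exI[of _ "\<lambda>n. x n ** y n"]) (auto intro: assms(1) mm.tendsto)
qed

theorem theorem7p8:
  fixes E :: "('v::real_vector, 4) vbundle"
    and h :: "torus \<Rightarrow> 'v \<Rightarrow> 'v \<Rightarrow> real"
    and D :: "'v conn"
    and hh :: "torus \<Rightarrow> 'v bivector \<Rightarrow> 'v bivector \<Rightarrow> real"
    and DD :: "'v bivector conn"
    and G :: "(real^4^4) set"
    and \<omega> :: "eps \<Rightarrow> 'v bivector^3"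
    and C\<^sub>1 C\<^sub>2 V\<^sub>2 :: "eps \<Rightarrow> real^3^3"
    and \<theta>\<^sub>1 \<theta>\<^sub>2 \<phi> :: "eps \<Rightarrow> real"
    and q\<^sub>1 q\<^sub>2 \<psi>\<^sub>1 \<psi>\<^sub>2 :: real
  assumes "oriented_vector_bundle E"
    and "bundle_metric E h"
    and "metric_connection E h D"
    and "topological_holonomy_group E h D G"
    and "induced_metric E h hh"
    and "induced_connection E D DD"
    and "\<And>\<epsilon>. holonomy_generators (Ext2_eps \<epsilon> E h) hh DD (\<omega> \<epsilon>) (C\<^sub>1 \<epsilon>) (C\<^sub>2 \<epsilon>)"
    and "\<And>\<epsilon>. \<theta>\<^sub>1 \<epsilon> \<in> {0..<2 * pi}" "\<And>\<epsilon>. C\<^sub>1 \<epsilon> = rot_C (\<theta>\<^sub>1 \<epsilon>)"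
    and "\<And>\<epsilon>. \<theta>\<^sub>2 \<epsilon> \<in> {0..<2 * pi}" "\<And>\<epsilon>. rotation_matrix (V\<^sub>2 \<epsilon>)"
        "\<And>\<epsilon>. C\<^sub>2 \<epsilon> = V\<^sub>2 \<epsilon> ** rot_C (\<theta>\<^sub>2 \<epsilon>) ** transpose (V\<^sub>2 \<epsilon>)"
    and "\<And>\<epsilon>. \<phi> \<epsilon> = vec_angle (vector [1, 0, 0]) (column 1 (V\<^sub>2 \<epsilon>))"
    and "\<theta>\<^sub>1 Eps_plus = q\<^sub>1 * pi" "\<theta>\<^sub>2 Eps_plus = \<psi>\<^sub>2 * pi"
    and "\<theta>\<^sub>1 Eps_minus = \<psi>\<^sub>1 * pi" "\<theta>\<^sub>2 Eps_minus = q\<^sub>2 * pi"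
    and "\<And>\<epsilon>. \<phi> \<epsilon> \<in> {0<..pi / 2}"
    and "q\<^sub>1 \<in> \<rat> - \<int>" "q\<^sub>2 \<in> \<rat> - \<int>"
    and "\<psi>\<^sub>1 \<notin> \<rat>" "\<psi>\<^sub>2 \<notin> \<rat>"
  shows "top_of_set (carrier SO_group) closure_of G = carrier SO_group"
proof -
  obtain b A\<^sub>1 A\<^sub>2 where A: "holonomy_generators E h D b A\<^sub>1 A\<^sub>2" and G: "G = generate SO_group {A\<^sub>1, A\<^sub>2}"
    using assms(4) unfolding topological_holonomy_group_def by blast
  have rot: "rotation_matrix A\<^sub>1" "rotation_matrix A\<^sub>2"
    using A by (auto simp: holonomy_generators_def holonomy_matrix_def)
  have sub: "G \<subseteq> carrier SO_group"
    unfolding G using rot by (intro group.generate_incl[OF SO_group_group]) (auto simp: SO_group_def)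
  have gens: "A\<^sub>1 \<in> G" "A\<^sub>2 \<in> G" "mat 1 \<in> G" "transpose A\<^sub>1 \<in> G" "transpose A\<^sub>2 \<in> G"
    using generate.incl[of A\<^sub>1 "{A\<^sub>1, A\<^sub>2}" SO_group] generate.incl[of A\<^sub>2 "{A\<^sub>1, A\<^sub>2}" SO_group]
      generate.one[of SO_group "{A\<^sub>1, A\<^sub>2}"]
      generate.inv[of A\<^sub>1 "{A\<^sub>1, A\<^sub>2}" SO_group] generate.inv[of A\<^sub>2 "{A\<^sub>1, A\<^sub>2}" SO_group]
    by (auto simp: G SO_group_inv rot) (simp add: SO_group_def)
  have mult: "X ** Y \<in> G" if "X \<in> G" "Y \<in> G" for X Y
    using generate.eng[of X SO_group "{A\<^sub>1, A\<^sub>2}" Y] that by (simp add: G SO_group_def)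
  obtain Pp where Pp: "linear Pp" "inj Pp"
    "\<And>v. A\<^sub>1 ** kap 1 (Pp v) ** transpose A\<^sub>1 = kap 1 (Pp (rot_C (q\<^sub>1 * pi) *v v))"
    "\<And>v. A\<^sub>2 ** kap 1 (Pp v) ** transpose A\<^sub>2
       = kap 1 (Pp ((V\<^sub>2 Eps_plus ** rot_C (\<psi>\<^sub>2 * pi) ** transpose (V\<^sub>2 Eps_plus)) *v v))"
    using holonomy_conjugation[OF assms(1,2,3,5,6) A assms(7)[of Eps_plus]]
    unfolding assms(9,12,14,15) eps_sgn.simps by blast
  obtain Pm where Pm: "linear Pm" "inj Pm"
    "\<And>v. A\<^sub>1 ** kap (-1) (Pm v) ** transpose A\<^sub>1 = kap (-1) (Pm (rot_C (\<psi>\<^sub>1 * pi) *v v))"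
    "\<And>v. A\<^sub>2 ** kap (-1) (Pm v) ** transpose A\<^sub>2
       = kap (-1) (Pm ((V\<^sub>2 Eps_minus ** rot_C (q\<^sub>2 * pi) ** transpose (V\<^sub>2 Eps_minus)) *v v))"
    using holonomy_conjugation[OF assms(1,2,3,5,6) A assms(7)[of Eps_minus]]
    unfolding assms(9,12,16,17) eps_sgn.simps by blast
  have angle: "vec_angle (vector [1, 0, 0]) (column 1 (V\<^sub>2 \<epsilon>)) \<in> {0<..pi / 2}" for \<epsilon>
    using assms(13,18) by metis
  have cl: "X \<in> closure G" if "X \<in> G" for X
    using that closure_subset by blast
  have "Y \<in> closure G" if "rotation_matrix Y" for Y
    by (rule closed_group_contains_rotations[OF closed_closure cl[OF gens(3)] closure_matrix_mult[OF mult]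
          cl[OF gens(1)] cl[OF gens(4)] _ cl[OF gens(2)] cl[OF gens(5)] _ Pp Pm
          assms(11) angle assms(11) angle assms(19,20,21,22) that])
       (use rot in \<open>simp_all add: rotation_matrix_def\<close>)
  then have "carrier SO_group \<subseteq> closure G"
    by (auto simp: SO_group_def)
  moreover have "carrier SO_group \<inter> G = G"
    using sub by blast
  ultimately show ?thesis
    by (auto simp: closure_of_subtopology)
qed

end
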